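(* Let $\alpha=(\alpha_1,\ldots,\alpha_n)$ be a composition such that $\alpha_i=\alpha_{i+1}$ for some $i\in\{1,\ldots,n-1\}$, and let $\sigma\in S_n$. Then $$E_{\alpha}^{\sigma}(x_1,\ldots,x_n;q,t)=E_{\alpha}^{\sigma s_i}(x_1,\ldots,x_n;q,t).$$
   Context: Permutations $\sigma\in S_n$ are written in one-line notation $\sigma=[\sigma_1,\ldots,\sigma_n]$, with product $(\sigma\pi)_j=\sigma_{\pi_j}$. $s_i$ is the simple transposition exchanging $i$ and $i+1$, so $\sigma s_i=[\sigma_1,\ldots,\sigma_{i-1},\sigma_{i+1},\sigma_i,\sigma_{i+2},\ldots,\sigma_n]$. Let $w_0=[n,n-1,\ldots,1]$ and $\mathrm{rev}(\sigma)=\sigma w_0=[\sigma_n,\ldots,\sigma_1]$. A composition of length $n$ is a sequence $\alpha=(\alpha_1,\ldots,\alpha_n)$ of nonnegative integers; $\mathrm{rev}(\alpha)=(\alpha_n,\ldots,\alpha_1)$, and $x^\alpha=\prod x_j^{\alpha_j}$. A permutation acts on polynomials in $\mathbb{Q}(q,t)[x_1,\ldots,x_n]$ by permuting variables, so $s_i$ swaps $x_i$ and $x_{i+1}$. The Demazure–Lusztig operators are $T_i(f)=t\,s_i(f)+(1-t)x_{i+1}\frac{f-s_i(f)}{x_i-x_{i+1}}$ for $i\in\{1,\ldots,n-1\}$; for a reduced expression $\sigma=s_{i_1}\cdots s_{i_k}$, $T_\sigma=T_{i_1}\circ\cdots\circ T_{i_k}$. Let $g(f)(x_1,\ldots,x_n)=f(x_2,\ldots,x_n,q^{-1}x_1)$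 and $Y_j=t^{j-1}T_{j-1}^{-1}\cdots T_1^{-1}\,g\,T_{n-1}\cdots T_j$. For a composition $\alpha$, the nonsymmetric Macdonald polynomial $E_\alpha$ is the unique element of $\mathbb{Q}(q,t)[x_1,\ldots,x_n]$ in which the coefficient of $x^\alpha$ is $1$ and $Y_jE_\alpha=q^{-\alpha_j}t^{k_j}E_\alpha$ for all $j$, where $k_j=|\{m<j:\alpha_m>\alpha_j\}|+|\{m>j:\alpha_m\ge\alpha_j\}|$. For $\sigma\in S_n$, the permuted-basement Macdonald polynomial is $E_\alpha^\sigma=t^{-\mathrm{twinv}(\alpha,\sigma)}T_{\mathrm{rev}(\sigma)}E_{\mathrm{rev}(\alpha)}$, where $\mathrm{twinv}(\alpha,\sigma)=|\{(j,m):j<m,\ \alpha_j\ge\alpha_m,\ \sigma_j<\sigma_m\}|$. *)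

theory Defs
  imports "HOL-Library.Poly_Mapping" "HOL-Computational_Algebra.Polynomial"
          "HOL-Computational_Algebra.Fraction_Field" "HOL-Combinatorics.Permutations"
begin

text \<open>The coefficient field Q(q,t): fractions of polynomials in t whose coefficients
  are polynomials in q over the rationals.\<close>
type_synonym qt = "rat poly poly fract"

definition qq :: qt where "qq = Fract [:[:0, 1:]:] 1"
definition tt :: qt where "tt = Fract [:0, 1:] 1"

text \<open>Multivariate polynomials over Q(q,t); variable x_j has index j (we use j = 1..n).\<close>
type_synonym mpoly = "(nat \<Rightarrow>\<^sub>0 nat) \<Rightarrow>\<^sub>0 qt"

definition Cst :: "qt \<Rightarrow> mpoly" where "Cst c = Poly_Mapping.single 0 c"
definition Var :: "nat \<Rightarrow> mpoly" where "Var j = Poly_Mapping.single (Poly_Mapping.single j 1) 1"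

definition in_vars :: "nat \<Rightarrow> mpoly \<Rightarrow> bool" where
  "in_vars n f \<longleftrightarrow> (\<forall>m \<in> Poly_Mapping.keys (f :: mpoly). Poly_Mapping.keys (m :: nat \<Rightarrow>\<^sub>0 nat) \<subseteq> {1..n})"

definition subst :: "(nat \<Rightarrow> mpoly) \<Rightarrow> mpoly \<Rightarrow> mpoly" where
  "subst s f = (\<Sum>m \<in> Poly_Mapping.keys f.
     Cst (Poly_Mapping.lookup f m) * (\<Prod>j \<in> Poly_Mapping.keys (m :: nat \<Rightarrow>\<^sub>0 nat). s j ^ Poly_Mapping.lookup m j))"

definition sw :: "nat \<Rightarrow> nat \<Rightarrow> nat" where
  "sw i j = (if j = i then i + 1 else if j = i + 1 then i else j)"

definition swp :: "nat \<Rightarrow> mpoly \<Rightarrow> mpoly" where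
  "swp i f = subst (\<lambda>j. Var (sw i j)) f"

definition divdiff :: "nat \<Rightarrow> mpoly \<Rightarrow> mpoly" where
  "divdiff i f = (THE h. f - swp i f = (Var i - Var (i + 1)) * h)"

definition DL :: "nat \<Rightarrow> mpoly \<Rightarrow> mpoly" where
  "DL i f = Cst tt * swp i f + Cst (1 - tt) * Var (i + 1) * divdiff i f"

definition gop :: "nat \<Rightarrow> mpoly \<Rightarrow> mpoly" where
  "gop n f = subst (\<lambda>j. if 1 \<le> j \<and> j < n then Var (j + 1)
                        else if j = n then Cst (inverse qq) * Var 1 else Var j) f"

definition Yop :: "nat \<Rightarrow> nat \<Rightarrow> mpoly \<Rightarrow> mpoly" where
  "Yop n j f = Cst (tt ^ (j - 1)) *
     fold (\<lambda>i h. inv (DL i) h) [1..<j] (gop n (fold (\<lambda>i h. DL i h) [j..<n] f))"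

text \<open>Compositions of length n are lists of length n; alpha_j = alpha ! (j - 1).\<close>
definition cmp :: "nat list \<Rightarrow> nat \<Rightarrow> nat" where "cmp alpha j = alpha ! (j - 1)"

definition xmono :: "nat list \<Rightarrow> (nat \<Rightarrow>\<^sub>0 nat)" where
  "xmono alpha = (\<Sum>j \<in> {1..length alpha}. Poly_Mapping.single j (cmp alpha j))"

definition kexp :: "nat list \<Rightarrow> nat \<Rightarrow> nat" where
  "kexp alpha j = card {m. 1 \<le> m \<and> m < j \<and> cmp alpha m > cmp alpha j}
                + card {m. j < m \<and> m \<le> length alpha \<and> cmp alpha m \<ge> cmp alpha j}"

definition Emac :: "nat list \<Rightarrow> mpoly" where
  "Emac alpha = (THE E. in_vars (length alpha) E \<and> Poly_Mapping.lookup E (xmono alpha) = 1 \<and>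
      (\<forall>j \<in> {1..length alpha}. Yop (length alpha) j E =
           Cst (inverse qq ^ cmp alpha j * tt ^ kexp alpha j) * E))"

text \<open>Permutations of {1..n} as functions (one-line notation sigma_j = sigma j),
  product (sigma pi)_j = sigma (pi j), i.e. sigma o pi.\<close>
definition word_of :: "nat \<Rightarrow> (nat \<Rightarrow> nat) \<Rightarrow> nat list \<Rightarrow> bool" where
  "word_of n \<sigma> ws \<longleftrightarrow> set ws \<subseteq> {1..<n} \<and> foldr (\<lambda>i p. sw i \<circ> p) ws id = \<sigma>"

definition reduced_word :: "nat \<Rightarrow> (nat \<Rightarrow> nat) \<Rightarrow> nat list \<Rightarrow> bool" where
  "reduced_word n \<sigma> ws \<longleftrightarrow> word_of n \<sigma> ws \<and> (\<forall>vs. word_of n \<sigma> vs \<longrightarrow> length ws \<le> length vs)"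

definition Tperm :: "nat \<Rightarrow> (nat \<Rightarrow> nat) \<Rightarrow> mpoly \<Rightarrow> mpoly" where
  "Tperm n \<sigma> f = foldr (\<lambda>i h. DL i h) (SOME ws. reduced_word n \<sigma> ws) f"

definition w0 :: "nat \<Rightarrow> nat \<Rightarrow> nat" where
  "w0 n j = (if 1 \<le> j \<and> j \<le> n then n + 1 - j else j)"

definition prev :: "nat \<Rightarrow> (nat \<Rightarrow> nat) \<Rightarrow> nat \<Rightarrow> nat" where
  "prev n \<sigma> = \<sigma> \<circ> w0 n"

definition twinv :: "nat list \<Rightarrow> (nat \<Rightarrow> nat) \<Rightarrow> nat" where
  "twinv alpha \<sigma> = card {(j, m). 1 \<le> j \<and> j < m \<and> m \<le> length alpha \<and>
                          cmp alpha j \<ge> cmp alpha m \<and> \<sigma> j < \<sigma> m}"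

definition Ebase :: "nat list \<Rightarrow> (nat \<Rightarrow> nat) \<Rightarrow> mpoly" where
  "Ebase alpha \<sigma> = Cst (inverse tt ^ twinv alpha \<sigma>) *
       Tperm (length alpha) (prev (length alpha) \<sigma>) (Emac (rev alpha))"

end

theory Submission
  imports Defs "HOL-Library.Product_Lexorder"
begin

text \<open>
  If \<open>\<beta>\<^sub>k = \<beta>\<^sub>k\<^sub>+\<^sub>1\<close>, then \<open>T\<^sub>k E\<^sub>\<beta> = t E\<^sub>\<beta>\<close>: by the relation
  \<open>T\<^sub>k Y\<^sub>k\<^sub>+\<^sub>1 T\<^sub>k = t Y\<^sub>k\<close> the vector \<open>(T\<^sub>k - t) E\<^sub>\<beta>\<close> is a joint eigenvector of the
  \<open>Y\<^sub>j\<close> whose eigenvalues are those of \<open>E\<^sub>\<beta>\<close> with the entries \<open>k\<close> and \<open>k + 1\<close> swapped. The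
  \<open>Y\<^sub>j\<close> are simultaneously triangular on monomials, so the eigenvalues of a nonzero joint
  eigenvector belong to some composition; its powers of \<open>q\<close> force this composition to be \<open>\<beta>\<close>, but
  then the powers of \<open>t\<close> disagree. Hence the vector vanishes.

  With \<open>\<beta> = rev \<alpha>\<close> and \<open>k = n - i\<close>, of the two permutations \<open>rev \<sigma>\<close> and
  \<open>rev (\<sigma> s\<^sub>i) = rev \<sigma> s\<^sub>k\<close> one is longer by one, which costs a factor \<open>t\<close> by the above (the
  choice of reduced words is irrelevant by Matsumoto's theorem), and \<open>twinv\<close> compensates for it.

  The same triangularity, together with the commutation of the \<open>Y\<^sub>j\<close>, shows that \<open>E\<^sub>\<beta>\<close> exists and
  is unique, so that the description operator in its definition is harmless.
\<close>

section \<open>Words and inversions in the symmetric group\<close>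

lemma sw_simps [simp]: "sw i i = Suc i" "sw i (Suc i) = i"
  by (simp_all add: sw_def)

lemma sw_other: "j \<noteq> i \<Longrightarrow> j \<noteq> Suc i \<Longrightarrow> sw i j = j"
  by (simp add: sw_def)

lemma sw_sw [simp]: "sw i (sw i j) = j"
  by (simp add: sw_def)

lemma comp_sw_sw [simp]: "f \<circ> sw i \<circ> sw i = f"
  by (simp add: fun_eq_iff)

lemma inj_sw: "inj (sw i)"
  by (metis injI sw_sw)

lemma sw_permutes: "1 \<le> i \<Longrightarrow> i < n \<Longrightarrow> sw i permutes {1..n}"
proof (rule bij_imp_permutes)
  assume "1 \<le> i" "i < n"
  then show "bij_betw (sw i) {1..n} {1..n}"
    by (intro bij_betw_byWitness[where f' = "sw i"]) (auto simp: sw_def)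
qed (auto simp: sw_def)

lemma sw_far_commute: "Suc i < j \<Longrightarrow> sw i \<circ> sw j = sw j \<circ> sw i"
  by (auto simp: fun_eq_iff sw_def)

lemma sw_braid: "sw i \<circ> sw (Suc i) \<circ> sw i = sw (Suc i) \<circ> sw i \<circ> sw (Suc i)"
  by (auto simp: fun_eq_iff sw_def)

section \<open>Pairs of positions and inversions\<close>

definition npairs :: "nat \<Rightarrow> (nat \<Rightarrow> nat \<Rightarrow> bool) \<Rightarrow> nat" where
  "npairs n Q = card {(j, m). 1 \<le> j \<and> j < m \<and> m \<le> n \<and> Q j m}"

lemma npairs_finite: "finite {(j, m). 1 \<le> j \<and> j < m \<and> m \<le> (n::nat) \<and> Q j m}"
  by (rule finite_subset[of _ "{1..n} \<times> {1..n}"]) auto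

lemma npairs_split:
  assumes "1 \<le> i" "i < n"
  shows "npairs n Q = card {(j, m). 1 \<le> j \<and> j < m \<and> m \<le> n \<and> (j, m) \<noteq> (i, Suc i) \<and> Q j m}
           + of_bool (Q i (Suc i))"
proof -
  let ?B = "{(j, m). 1 \<le> j \<and> j < m \<and> m \<le> n \<and> (j, m) \<noteq> (i, Suc i) \<and> Q j m}"
  have fin: "finite ?B"
    by (rule finite_subset[OF _ npairs_finite[of n Q]]) auto
  show ?thesis
  proof (cases "Q i (Suc i)")
    case True
    then have "{(j, m). 1 \<le> j \<and> j < m \<and> m \<le> n \<and> Q j m} = insert (i, Suc i) ?B"
      using assms by auto
    then show ?thesis using True fin by (simp add: npairs_def)
  next
    case False
    then have "{(j, m). 1 \<le> j \<and> j < m \<and> m \<le> n \<and> Q j m} = ?B" by auto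
    then show ?thesis using False by (simp add: npairs_def)
  qed
qed

text \<open>\<open>sw i\<close> permutes the pairs j < m other than (i, i + 1), so only this one
  pair can change the count. The predicate is arbitrary because inversions and \<open>twinv\<close>
  are both counted this way; the corrections stand on both sides to avoid subtraction.\<close>

lemma npairs_sw:
  assumes "1 \<le> i" "i < n"
  shows "npairs n (\<lambda>j m. Q (sw i j) (sw i m)) + of_bool (Q i (Suc i))
       = npairs n Q + of_bool (Q (Suc i) i)"
proof -
  let ?B = "\<lambda>Q. {(j, m). 1 \<le> j \<and> j < m \<and> m \<le> n \<and> (j, m) \<noteq> (i, Suc i) \<and> Q j m}"
  have sw: "1 \<le> sw i j \<and> sw i j < sw i m \<and> sw i m \<le> n \<and> (sw i j, sw i m) \<noteq> (i, Suc i)"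
    if "1 \<le> j" "j < m" "m \<le> n" "(j, m) \<noteq> (i, Suc i)" for j m
    using that assms by (auto simp: sw_def)
  have "bij_betw (map_prod (sw i) (sw i)) (?B (\<lambda>j m. Q (sw i j) (sw i m))) (?B Q)"
  proof (rule bij_betw_byWitness[where f' = "map_prod (sw i) (sw i)"])
    show "map_prod (sw i) (sw i) ` ?B (\<lambda>j m. Q (sw i j) (sw i m)) \<subseteq> ?B Q"
      "map_prod (sw i) (sw i) ` ?B Q \<subseteq> ?B (\<lambda>j m. Q (sw i j) (sw i m))"
      using sw by fastforce+
  qed auto
  then have "card (?B (\<lambda>j m. Q (sw i j) (sw i m))) = card (?B Q)"
    by (rule bij_betw_same_card)
  then show ?thesis
    using npairs_split[OF assms, of Q] npairs_split[OF assms, of "\<lambda>j m. Q (sw i j) (sw i m)"]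
    by simp
qed

definition ninv :: "nat \<Rightarrow> (nat \<Rightarrow> nat) \<Rightarrow> nat" where
  "ninv n p = npairs n (\<lambda>j m. p m < p j)"

lemma ninv_sw_ascent:
  assumes "1 \<le> i" "i < n" "p i < p (Suc i)"
  shows "ninv n (p \<circ> sw i) = Suc (ninv n p)"
  using npairs_sw[OF assms(1,2), of "\<lambda>j m. p m < p j"] assms(3)
  by (simp add: ninv_def)

lemma ninv_sw_descent:
  assumes "1 \<le> i" "i < n" "p (Suc i) < p i"
  shows "ninv n p = Suc (ninv n (p \<circ> sw i))"
  using ninv_sw_ascent[of i n "p \<circ> sw i"] assms by simp

lemma ninv_id: "ninv n id = 0"
proof -
  have "{(j, m). 1 \<le> j \<and> j < m \<and> m \<le> n \<and> id m < id j} = {}" by auto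
  then show ?thesis unfolding ninv_def npairs_def by (simp only: card.empty)
qed

text \<open>Climbing from p 1 >= 1 gives i <= p i; going down from p n <= n gives the converse
  bound.\<close>

lemma no_descent_id:
  assumes "p permutes {1..n}" "\<And>i. 1 \<le> i \<Longrightarrow> i < n \<Longrightarrow> p i < p (Suc i)"
  shows "p = id"
proof
  fix j
  have ge: "i \<le> p i" if "1 \<le> i" "i \<le> n" for i
    using that
  proof (induction i rule: nat_induct_at_least)
    case base
    then show ?case using permutes_in_image[OF assms(1), of 1] by auto
  next
    case (Suc i)
    then show ?case using assms(2)[of i] by simp
  qed
  have le: "p (n - i) \<le> n - i" if "i < n" for i
    using that
  proof (induction i)
    case 0
    then show ?case using permutes_in_image[OF assms(1), of n] by auto
  next
    case (Suc i)
    then show ?case using assms(2)[of "n - Suc i"] by (simp add: Suc_diff_Suc) linarith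
  qed
  show "p j = id j"
  proof (cases "j \<in> {1..n}")
    case True
    then show ?thesis using ge[of j] le[of "n - j"] by auto
  next
    case False
    then show ?thesis using permutes_not_in[OF assms(1)] by simp
  qed
qed

lemma descent_exists:
  assumes "p permutes {1..n}" "p \<noteq> id"
  obtains i where "1 \<le> i" "i < n" "p (Suc i) < p i"
proof -
  obtain i where i: "1 \<le> i" "i < n" "\<not> p i < p (Suc i)"
    using no_descent_id[OF assms(1)] assms(2) by blast
  moreover have "p i \<noteq> p (Suc i)"
    using permutes_inj[OF assms(1)] by (metis injD n_not_Suc_n)
  ultimately show ?thesis using that by (meson linorder_neqE_nat)
qed

section \<open>Reduced words and Matsumoto's theorem\<close>

abbreviation word_perm :: "nat list \<Rightarrow> nat \<Rightarrow> nat" where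
  "word_perm ws \<equiv> foldr (\<lambda>i p. sw i \<circ> p) ws id"

lemma foldr_sw: "foldr (\<lambda>i p. sw i \<circ> p) ws q = word_perm ws \<circ> q"
  by (induction ws) (simp_all add: o_assoc)

lemma word_perm_snoc: "word_perm (ws @ [i]) = word_perm ws \<circ> sw i"
  by (simp add: foldr_sw[of ws "sw i"])

lemma word_of_snoc:
  "word_of n p (ws @ [i]) \<longleftrightarrow> 1 \<le> i \<and> i < n \<and> word_of n (p \<circ> sw i) ws"
proof -
  have "word_perm ws \<circ> sw i = p \<longleftrightarrow> word_perm ws = p \<circ> sw i"
    by (metis comp_sw_sw)
  then show ?thesis by (auto simp: word_of_def word_perm_snoc simp del: foldr_append)
qed

lemma word_of_permutes: "word_of n p ws \<Longrightarrow> p permutes {1..n}"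
proof (induction ws arbitrary: p rule: rev_induct)
  case Nil
  then have "p = id" by (simp add: word_of_def)
  then show ?case by (simp only: permutes_id)
next
  case (snoc i ws)
  then have "p \<circ> sw i permutes {1..n}" "1 \<le> i" "i < n" by (auto simp: word_of_snoc)
  then have "p \<circ> sw i \<circ> sw i permutes {1..n}"
    using permutes_compose[OF sw_permutes] by blast
  then show ?case by simp
qed

lemma ninv_le_length: "word_of n p ws \<Longrightarrow> ninv n p \<le> length ws"
proof (induction ws arbitrary: p rule: rev_induct)
  case Nil
  then have "p = id" by (simp add: word_of_def)
  then show ?case by (simp only: ninv_id le0)
next
  case (snoc i ws)
  then have i: "1 \<le> i" "i < n" and IH: "ninv n (p \<circ> sw i) \<le> length ws"
    by (auto simp: word_of_snoc)
  have "p i \<noteq> p (Suc i)"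
    using permutes_inj[OF word_of_permutes[OF snoc.prems]] by (metis injD n_not_Suc_n)
  then have "ninv n p \<le> Suc (ninv n (p \<circ> sw i))"
    using ninv_sw_ascent[OF i, of p] ninv_sw_descent[OF i, of p] by linarith
  then show ?case using IH by simp
qed

lemma word_of_length_ninv:
  assumes "p permutes {1..n}"
  shows "\<exists>ws. word_of n p ws \<and> length ws = ninv n p"
  using assms
proof (induction "ninv n p" arbitrary: p rule: less_induct)
  case less
  show ?case
  proof (cases "p = id")
    case True
    then have "word_of n p [] \<and> length [] = ninv n p" by (simp add: word_of_def ninv_id)
    then show ?thesis by blast
  next
    case False
    then obtain i where i: "1 \<le> i" "i < n" "p (Suc i) < p i"
      using descent_exists less.prems by blast
    then have "p \<circ> sw i permutes {1..n}"
      using permutes_compose[OF sw_permutes less.prems] by blast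
    then obtain ws where "word_of n (p \<circ> sw i) ws" "length ws = ninv n (p \<circ> sw i)"
      using less.hyps ninv_sw_descent[OF i] by (metis lessI)
    then have "word_of n p (ws @ [i]) \<and> length (ws @ [i]) = ninv n p"
      using i ninv_sw_descent[OF i] by (simp add: word_of_snoc)
    then show ?thesis by blast
  qed
qed

text \<open>One letter changes the inversion number by one, which bounds the length from below;
  removing descents one at a time attains the bound.\<close>

lemma reduced_word_iff: "reduced_word n p ws \<longleftrightarrow> word_of n p ws \<and> length ws = ninv n p"
  unfolding reduced_word_def
  by (metis le_antisym ninv_le_length word_of_length_ninv word_of_permutes)

lemma reduced_word_exists: "p permutes {1..n} \<Longrightarrow> \<exists>ws. reduced_word n p ws"
  using word_of_length_ninv by (simp add: reduced_word_iff)

lemma reduced_word_snocI: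
  assumes "reduced_word n (p \<circ> sw i) ws" "1 \<le> i" "i < n" "p (Suc i) < p i"
  shows "reduced_word n p (ws @ [i])"
  using assms ninv_sw_descent[of i n p] by (simp add: reduced_word_iff word_of_snoc)

lemma reduced_word_snocD:
  assumes "reduced_word n p (ws @ [i])"
  shows "reduced_word n (p \<circ> sw i) ws" "1 \<le> i" "i < n" "p (Suc i) < p i"
proof -
  have w: "word_of n (p \<circ> sw i) ws" and i: "1 \<le> i" "i < n" and l: "Suc (length ws) = ninv n p"
    using assms by (auto simp: reduced_word_iff word_of_snoc)
  have "p i \<noteq> p (Suc i)"
    using permutes_inj[OF word_of_permutes] assms
    by (metis injD n_not_Suc_n reduced_word_iff)
  \<comment> \<open>At an ascent the shorter word \<open>ws\<close> would represent a permutation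
    with more inversions than \<open>ws\<close> has letters.\<close>
  moreover have "\<not> p i < p (Suc i)"
    using ninv_sw_ascent[OF i, of p] ninv_le_length[OF w] l by auto
  ultimately show d: "p (Suc i) < p i" by simp
  show "1 \<le> i" "i < n" by (rule i)+
  show "reduced_word n (p \<circ> sw i) ws"
    using w l ninv_sw_descent[OF i d] by (simp add: reduced_word_iff)
qed

text \<open>Induction on the length. If the last letters i and j differ, both are descents of p, so
  p has two further reduced words with a common initial part that end in the two sides of the
  relation between i and j. By the induction hypothesis each given word agrees with one of these,
  and the relation for \<open>T\<close> identifies them.\<close>

lemma matsumoto:
  fixes T :: "nat \<Rightarrow> 'a \<Rightarrow> 'a"
  assumes braid: "\<And>i f. T i (T (Suc i) (T i f)) = T (Suc i) (T i (T (Suc i) f))"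
    and far: "\<And>i j f. Suc i < j \<Longrightarrow> T i (T j f) = T j (T i f)"
    and "reduced_word n p as" "reduced_word n p bs"
  shows "foldr T as f = foldr T bs f"
  using assms(3,4)
proof (induction "length as" arbitrary: p as bs f rule: less_induct)
  case less
  have len: "length as = length bs"
    using less.prems by (simp add: reduced_word_iff)
  have perm: "p permutes {1..n}"
    using less.prems(1) word_of_permutes unfolding reduced_word_iff by blast
  show ?case
  proof (cases as rule: rev_cases)
    case Nil
    then show ?thesis using len by simp
  next
    case (snoc as' i)
    then obtain bs' j where bs: "bs = bs' @ [j]"
      using len by (cases bs rule: rev_cases) auto
    have A: "reduced_word n (p \<circ> sw i) as'" "1 \<le> i" "i < n" "p (Suc i) < p i"
      using reduced_word_snocD less.prems(1) snoc by auto
    have B: "reduced_word n (p \<circ> sw j) bs'" "1 \<le> j" "j < n" "p (Suc j) < p j"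
      using reduced_word_snocD less.prems(2) bs by auto
    have IHa: "foldr T as' h = foldr T cs h" if "reduced_word n (p \<circ> sw i) cs" for cs h
      using less.hyps[OF _ A(1) that] snoc by simp
    have IHb: "foldr T bs' h = foldr T cs h" if "reduced_word n (p \<circ> sw j) cs" for cs h
      using less.hyps[OF _ B(1) that] bs len by simp
    \<comment> \<open>Stated for i < j with arbitrary remaining words, so that i > j follows by
      exchanging the roles.\<close>
    have sym: "\<exists>us. foldr T as' (T i f) = foldr T us f \<and> foldr T bs' (T j f) = foldr T us f"
      if A: "1 \<le> i" "i < n" "p (Suc i) < p i"
        and B: "1 \<le> j" "j < n" "p (Suc j) < p j" and ij: "i < j"
        and IHa: "\<And>cs h. reduced_word n (p \<circ> sw i) cs \<Longrightarrow> foldr T as' h = foldr T cs h"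
        and IHb: "\<And>cs h. reduced_word n (p \<circ> sw j) cs \<Longrightarrow> foldr T bs' h = foldr T cs h"
      for i j as' bs'
    proof (cases "j = Suc i")
      case True
      \<comment> \<open>Here p i > p (i + 1) > p (i + 2), and p is \<open>?w\<close> followed by the
        longest element on these three positions; every letter stripped on the way is a
        descent.\<close>
      let ?w = "p \<circ> sw i \<circ> sw j \<circ> sw i"
      have w: "?w = p \<circ> sw j \<circ> sw i \<circ> sw j"
        using sw_braid[of i] True by (simp add: fun_eq_iff)
      have "?w permutes {1..n}"
        using perm A B by (intro permutes_compose sw_permutes)
      then obtain cs where cs: "reduced_word n ?w cs" using reduced_word_exists by blast
      have "reduced_word n (p \<circ> sw i \<circ> sw j) (cs @ [i])"
        by (rule reduced_word_snocI[OF cs])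
           (use A B True in \<open>auto simp: sw_other\<close>)
      then have "reduced_word n (p \<circ> sw i) ((cs @ [i]) @ [j])"
        by (rule reduced_word_snocI)
           (use A B True in \<open>auto simp: sw_other\<close>)
      then have a: "foldr T as' (T i f) = foldr T (cs @ [i, j]) (T i f)"
        by (intro IHa) simp
      have "reduced_word n (p \<circ> sw j \<circ> sw i) (cs @ [j])"
        by (rule reduced_word_snocI[OF cs[unfolded w]])
           (use A B True in \<open>auto simp: sw_other\<close>)
      then have "reduced_word n (p \<circ> sw j) ((cs @ [j]) @ [i])"
        by (rule reduced_word_snocI)
           (use A B True in \<open>auto simp: sw_other\<close>)
      then have b: "foldr T bs' (T j f) = foldr T (cs @ [j, i]) (T j f)"
        by (intro IHb) simp
      show ?thesis using a b True
        by (intro exI[of _ "cs @ [i, j, i]"]) (simp add: braid)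
    next
      case False
      then have ij': "Suc i < j" using ij by simp
      let ?w = "p \<circ> sw i \<circ> sw j"
      have w: "?w = p \<circ> sw j \<circ> sw i"
        using sw_far_commute[OF ij'] by (simp add: fun_eq_iff)
      have "?w permutes {1..n}"
        using perm A B by (intro permutes_compose sw_permutes)
      then obtain cs where cs: "reduced_word n ?w cs" using reduced_word_exists by blast
      have "reduced_word n (p \<circ> sw i) (cs @ [j])"
        by (rule reduced_word_snocI[OF cs])
           (use A B ij' in \<open>auto simp: sw_other\<close>)
      then have a: "foldr T as' (T i f) = foldr T (cs @ [j]) (T i f)"
        by (rule IHa)
      have "reduced_word n (p \<circ> sw j) (cs @ [i])"
        by (rule reduced_word_snocI[OF cs[unfolded w]])
           (use A B ij' in \<open>auto simp: sw_other\<close>)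
      then have b: "foldr T bs' (T j f) = foldr T (cs @ [i]) (T j f)"
        by (rule IHb)
      show ?thesis using a b far[OF ij']
        by (intro exI[of _ "cs @ [j, i]"]) simp
    qed
    show ?thesis
    proof (cases i j rule: linorder_cases)
      case less
      then show ?thesis using sym[OF A(2-4) B(2-4) less IHa IHb] snoc bs by auto
    next
      case equal
      then show ?thesis using IHa[of bs'] B snoc bs by simp
    next
      case greater
      then show ?thesis using sym[OF B(2-4) A(2-4) greater IHb IHa] snoc bs by auto
    qed
  qed
qed

section \<open>Commuting elements in the affine braid group\<close>

text \<open>Relations of the extended affine braid group of GL_n acting on a set, with
  \<open>g\<close> rotating the indices.\<close>

locale affine_braid =
  fixes n :: nat and T Ti :: "nat \<Rightarrow> 'a \<Rightarrow> 'a" and g :: "'a \<Rightarrow> 'a"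
  assumes T_Ti: "T i (Ti i f) = f"
    and Ti_T: "Ti i (T i f) = f"
    and braid: "T i (T (Suc i) (T i f)) = T (Suc i) (T i (T (Suc i) f))"
    and far: "Suc i < j \<Longrightarrow> T i (T j f) = T j (T i f)"
    and shift: "1 \<le> i \<Longrightarrow> Suc i < n \<Longrightarrow> g (T i f) = T (Suc i) (g f)"
    and shift2: "2 \<le> n \<Longrightarrow> g (g (T (n - 1) f)) = T 1 (g (g f))"
begin

definition up :: "nat \<Rightarrow> nat \<Rightarrow> 'a \<Rightarrow> 'a" where
  "up j l = fold T [j..<l]"

definition down :: "nat \<Rightarrow> 'a \<Rightarrow> 'a" where
  "down j = fold Ti [1..<j]"

text \<open>The operator Y_j without its power of t; these operators represent translations in the
  affine braid group.\<close>

definition Z :: "nat \<Rightarrow> 'a \<Rightarrow> 'a" where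
  "Z j f = down j (g (up j n f))"

lemma up_Suc: "j \<le> l \<Longrightarrow> up j (Suc l) f = T l (up j l f)"
  by (simp add: up_def)

lemma up_first: "j < l \<Longrightarrow> up j l f = up (Suc j) l (T j f)"
  by (simp add: up_def upt_conv_Cons)

lemma up_empty [simp]: "up j j f = f"
  by (simp add: up_def)

lemma down_1 [simp]: "down (Suc 0) f = f"
  by (simp add: down_def)

lemma down_Suc: "1 \<le> j \<Longrightarrow> down (Suc j) f = Ti j (down j f)"
  by (simp add: down_def)

lemma T_far: "Suc i < j \<or> Suc j < i \<Longrightarrow> T i (T j f) = T j (T i f)"
  using far[of i j f] far[of j i f] by auto

lemma commute_Ti:
  assumes "\<And>f. A (T i f) = T i (A f)"
  shows "A (Ti i f) = Ti i (A f)"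
  by (metis assms T_Ti Ti_T)

lemma T_Ti_far: "Suc i < j \<or> Suc j < i \<Longrightarrow> T i (Ti j f) = Ti j (T i f)"
  by (rule commute_Ti) (rule T_far)

lemma up_T_far: "Suc k < j \<or> l < k \<Longrightarrow> up j l (T k f) = T k (up j l f)"
proof (induction l)
  case 0
  then show ?case by (simp add: up_def)
next
  case (Suc l)
  show ?case
  proof (cases "j \<le> l")
    case True
    then show ?thesis using Suc by (auto simp: up_Suc T_far)
  next
    case False
    then show ?thesis by (simp add: up_def)
  qed
qed

text \<open>T_{k+1} passes T_j, ..., T_{k-1}, becomes T_k by the braid relation with T_k and
  T_{k+1}, and then passes the remaining factors.\<close>

lemma up_T:
  assumes "j \<le> k" "Suc k < l"
  shows "up j l (T (Suc k) f) = T k (up j l f)"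
  using assms(2)
proof (induction l)
  case 0
  then show ?case by simp
next
  case (Suc l)
  show ?case
  proof (cases "l = Suc k")
    case True
    then show ?thesis using assms
      by (simp add: up_Suc up_T_far braid)
  next
    case False
    then show ?thesis using assms Suc by (simp add: up_Suc T_far)
  qed
qed

lemma down_T_far: "j < k \<Longrightarrow> down j (T k f) = T k (down j f)"
proof (induction j)
  case 0
  then show ?case by (simp add: down_def)
next
  case (Suc j)
  then show ?case
    by (cases "j = 0") (auto simp: down_Suc T_Ti_far)
qed

lemma braid_inverse: "Ti (Suc k) (Ti k (T (Suc k) f)) = T k (Ti (Suc k) (Ti k f))"
  by (metis braid T_Ti Ti_T)

lemma down_T:
  assumes "1 \<le> k" "Suc k < j"
  shows "down j (T (Suc k) f) = T k (down j f)"
  using assms(2)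
proof (induction j)
  case 0
  then show ?case by simp
next
  case (Suc j)
  show ?case
  proof (cases "j = Suc k")
    case True
    then show ?thesis using assms
      by (simp add: down_Suc down_T_far braid_inverse)
  next
    case False
    then show ?thesis using assms Suc by (simp add: down_Suc T_Ti_far)
  qed
qed

text \<open>If k < j, then \<open>g\<close> raises the index k and the inverses on its left lower it
  again; if k > j, the product T_{n-1} ... T_j lowers the index first and \<open>g\<close> restores
  it.\<close>

lemma Z_T_commute:
  assumes "1 \<le> j" "j \<le> n" "1 \<le> k" "k < n" "k \<noteq> j" "Suc k \<noteq> j"
  shows "Z j (T k f) = T k (Z j f)"
proof (cases "k < j")
  case True
  then have "Suc k < j" using assms by simp
  then show ?thesis using assms by (simp add: Z_def up_T_far shift down_T)
next
  case False
  then obtain k' where k: "k = Suc k'" "j \<le> k'" using assms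
    by (metis Suc_leI less_imp_Suc_add less_add_Suc1 linorder_neqE_nat not_less_eq_eq)
  then show ?thesis using assms by (simp add: Z_def up_T shift down_T_far)
qed

lemma Z_Suc: "1 \<le> j \<Longrightarrow> j < n \<Longrightarrow> Z (Suc j) f = Ti j (Z j (Ti j f))"
  by (simp add: Z_def down_Suc up_first[of j] T_Ti)

lemma Z_conj: "1 \<le> j \<Longrightarrow> j < n \<Longrightarrow> T j (Z (Suc j) (T j f)) = Z j f"
  by (simp add: Z_Suc T_Ti Ti_T)

lemma up_up: "j \<le> l \<Longrightarrow> l < n \<Longrightarrow> up j n (up (Suc j) (Suc l) f) = up j l (up j n f)"
proof (induction l arbitrary: f)
  case 0
  then show ?case by (simp add: up_def)
next
  case (Suc l)
  show ?case
  proof (cases "j = Suc l")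
    case True
    then show ?thesis by simp
  next
    case False
    then show ?thesis using Suc by (simp add: up_Suc up_T)
  qed
qed

lemma g_up: "1 \<le> j \<Longrightarrow> j \<le> l \<Longrightarrow> l < n \<Longrightarrow> up (Suc j) (Suc l) (g f) = g (up j l f)"
proof (induction l)
  case 0
  then show ?case by simp
next
  case (Suc l)
  show ?case
  proof (cases "j = Suc l")
    case True
    then show ?thesis by simp
  next
    case False
    then show ?thesis using Suc by (simp add: up_Suc shift)
  qed
qed

text \<open>With U = T_{n-1} ... T_2 one has Z_1 = g U T_1 and Z_2 = T_1^{-1} g U, so the claim is
  that T_1 commutes with (g U)^2. Collecting both copies of \<open>g\<close> on the left lets
  \<open>shift2\<close> turn T_1 into T_{n-1}, and \<open>up_up\<close> rearranges what
  remains.\<close>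

lemma Z_1_2_commute:
  assumes "2 \<le> n"
  shows "Z 1 (Z 2 f) = Z 2 (Z 1 f)"
proof -
  obtain l where n: "n = Suc l" "1 \<le> l" using assms by (cases n) auto
  let ?U = "up 2 n"
  have U: "Z 1 h = g (?U (T 1 h))" for h
    using assms by (simp add: Z_def up_first[of "Suc 0"] numeral_2_eq_2)
  have gU: "?U (g h) = g (up 1 l h)" for h
    using g_up[of 1 l h] n by (simp add: numeral_2_eq_2)
  have Z2: "Z 2 h = Ti 1 (g (?U h))" for h
    using Z_Suc[of 1 h] U[of "Ti 1 h"] assms by (simp add: T_Ti numeral_2_eq_2)
  have "T 1 (g (?U (g (?U f)))) = T 1 (g (g (up 1 l (?U f))))"
    by (simp add: gU)
  also have "\<dots> = g (g (T l (up 1 l (?U f))))"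
    using shift2 assms n by simp
  also have "T l (up 1 l (?U f)) = up 1 n (?U f)"
    using n by (simp add: up_Suc)
  also have "\<dots> = up 1 l (up 1 n f)"
    using up_up[of 1 l f] n by (simp add: numeral_2_eq_2)
  also have "up 1 n f = ?U (T 1 f)"
    using assms by (simp add: up_first[of "Suc 0"] numeral_2_eq_2)
  also have "g (g (up 1 l (?U (T 1 f)))) = g (?U (g (?U (T 1 f))))"
    by (simp add: gU)
  finally have "T 1 (g (?U (g (?U f)))) = g (?U (g (?U (T 1 f))))" .
  then have "Ti 1 (g (?U (g (?U (T 1 f))))) = g (?U (g (?U f)))"
    by (metis Ti_T)
  then show ?thesis by (simp add: Z2 U T_Ti del: One_nat_def)
qed

lemma Z_Ti_commute:
  assumes "1 \<le> j" "j \<le> n" "1 \<le> k" "k < n" "k \<noteq> j" "Suc k \<noteq> j"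
  shows "Z j (Ti k f) = Ti k (Z j f)"
  by (rule commute_Ti) (rule Z_T_commute[OF assms])

text \<open>Starting from Z_2, the recursion \<open>Z_Suc\<close> propagates the claim, since Z_1
  commutes with T_k^{-1} for 2 <= k < n.\<close>

lemma Z_1_commute:
  assumes "1 < k" "k \<le> n"
  shows "Z 1 (Z k f) = Z k (Z 1 f)"
  using assms
proof (induction k arbitrary: f)
  case 0
  then show ?case by simp
next
  case (Suc k)
  show ?case
  proof (cases "k = 1")
    case True
    then show ?thesis using Z_1_2_commute[of f] Suc by (simp add: numeral_2_eq_2)
  next
    case False
    then show ?thesis using Suc by (simp add: Z_Suc Z_Ti_commute)
  qed
qed

lemma Z_less_commute:
  assumes "1 \<le> j" "j < k" "k \<le> n"
  shows "Z j (Z k f) = Z k (Z j f)"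
  using assms
proof (induction j arbitrary: f rule: nat_induct_at_least)
  case base
  then show ?case using Z_1_commute by simp
next
  case (Suc j)
  have "Z (Suc j) (Z k f) = Ti j (Z j (Z k (Ti j f)))"
    using Suc.hyps Suc.prems by (simp add: Z_Suc Z_Ti_commute)
  also have "\<dots> = Ti j (Z k (Z j (Ti j f)))"
    using Suc by simp
  also have "\<dots> = Z k (Z (Suc j) f)"
    using Suc.hyps Suc.prems by (simp add: Z_Suc Z_Ti_commute)
  finally show ?case .
qed

theorem Z_commute:
  assumes "1 \<le> j" "j \<le> n" "1 \<le> k" "k \<le> n"
  shows "Z j (Z k f) = Z k (Z j f)"
  using assms Z_less_commute[of j k f] Z_less_commute[of k j f]
  by (cases j k rule: linorder_cases) auto

end

section \<open>Demazure--Lusztig operators\<close>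

abbreviation lookup where "lookup \<equiv> Poly_Mapping.lookup"
abbreviation keys where "keys \<equiv> Poly_Mapping.keys"
abbreviation single where "single \<equiv> Poly_Mapping.single"
abbreviation map_key where "map_key \<equiv> Poly_Mapping.map_key"

definition Mon :: "(nat \<Rightarrow>\<^sub>0 nat) \<Rightarrow> mpoly" where "Mon m = single m 1"

lemma Cst_simps [simp]: "Cst 0 = 0" "Cst 1 = 1"
  by (simp_all add: Cst_def)

lemma Cst_add: "Cst (a + b) = Cst a + Cst b"
  by (simp add: Cst_def single_add)

lemma Cst_diff: "Cst (a - b) = Cst a - Cst b"
  by (simp add: Cst_def single_diff)

lemma Cst_mult: "Cst (a * b) = Cst a * Cst b"
  by (simp add: Cst_def mult_single)

lemma Cst_power: "Cst (a ^ k) = Cst a ^ k"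
  by (induction k) (simp_all add: Cst_mult)

lemma lookup_Cst_mult [simp]: "lookup (Cst c * f) m = c * lookup f m"
proof -
  have "lookup (Poly_Mapping.map ((*) c) f) m = c * lookup f m"
    by (simp add: Poly_Mapping.map.rep_eq when_def)
  then show ?thesis by (simp add: Cst_def mult_map_scale_conv_mult)
qed

lemma lookup_Mon: "lookup (Mon m) m' = (if m = m' then 1 else 0)"
  by (simp add: Mon_def lookup_single when_def)

lemma keys_Mon [simp]: "keys (Mon m) = {m}"
  by (simp add: Mon_def)

lemma Mon_mult: "Mon m * Mon m' = Mon (m + m')"
  by (simp add: Mon_def mult_single)

lemma Mon_0 [simp]: "Mon 0 = 1"
  by (simp add: Mon_def)

lemma Var_eq_Mon: "Var j = Mon (single j 1)"
  by (simp add: Var_def Mon_def)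

lemma Var_power: "Var j ^ k = Mon (single j k)"
  by (induction k) (simp_all add: Var_eq_Mon Mon_mult flip: single_add)

lemma mpoly_expand: "f = (\<Sum>m\<in>keys f. Cst (lookup f m) * Mon m)"
proof (rule poly_mapping_eqI)
  fix m
  have "lookup (\<Sum>m\<in>keys f. Cst (lookup f m) * Mon m) m
      = (\<Sum>m'\<in>keys f. if m' = m then lookup f m' else 0)"
    unfolding lookup_sum by (rule sum.cong) (auto simp: lookup_Mon)
  also have "\<dots> = lookup f m"
    by (simp add: in_keys_iff)
  finally show "lookup f m = lookup (\<Sum>m\<in>keys f. Cst (lookup f m) * Mon m) m" ..
qed

definition lin :: "(mpoly \<Rightarrow> mpoly) \<Rightarrow> bool" where
  "lin A \<longleftrightarrow> (\<forall>f h. A (f + h) = A f + A h) \<and> (\<forall>c f. A (Cst c * f) = Cst c * A f)"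

lemma linI:
  assumes "\<And>f h. A (f + h) = A f + A h" "\<And>c f. A (Cst c * f) = Cst c * A f"
  shows "lin A"
  using assms by (simp add: lin_def)

lemma lin_add: "lin A \<Longrightarrow> A (f + h) = A f + A h"
  by (simp add: lin_def)

lemma lin_scale: "lin A \<Longrightarrow> A (Cst c * f) = Cst c * A f"
  by (simp add: lin_def)

lemma lin_0: "lin A \<Longrightarrow> A 0 = 0"
  using lin_scale[of A 0 0] by simp

lemma lin_diff:
  assumes "lin A"
  shows "A (f - h) = A f - A h"
  using lin_add[OF assms, of "f - h" h] by simp

lemma lin_sum:
  assumes "lin A"
  shows "A (sum f S) = (\<Sum>x\<in>S. A (f x))"
  by (induction S rule: infinite_finite_induct) (simp_all add: lin_0 lin_add assms)

lemma lin_expand: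
  assumes "lin A"
  shows "A f = (\<Sum>m\<in>keys f. Cst (lookup f m) * A (Mon m))"
  by (subst mpoly_expand) (simp add: lin_sum lin_scale assms)

lemma lin_eqI:
  assumes "lin A" "lin B" "\<And>m. A (Mon m) = B (Mon m)"
  shows "A f = B f"
  by (simp add: lin_expand[OF assms(1), of f] lin_expand[OF assms(2), of f] assms(3))

lemma lin_compose:
  assumes "lin A" "lin B"
  shows "lin (\<lambda>f. A (B f))"
  using assms by (simp add: lin_def)

lemma lin_mult: "lin (\<lambda>f. h * f)"
  by (simp add: lin_def algebra_simps)

lemma lin_mult_right: "lin (\<lambda>f. f * h)"
  by (simp add: lin_def algebra_simps)

lemma lin_id: "lin (\<lambda>f. f)"
  by (simp add: lin_def)

lemma lin_minus:
  assumes "lin A" "lin B"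
  shows "lin (\<lambda>f. A f - B f)"
  using assms by (simp add: lin_def algebra_simps)

section \<open>Substitution homomorphisms\<close>

definition evm :: "(nat \<Rightarrow> mpoly) \<Rightarrow> (nat \<Rightarrow>\<^sub>0 nat) \<Rightarrow> mpoly" where
  "evm s m = (\<Prod>j\<in>keys m. s j ^ lookup m j)"

lemma evm_superset:
  assumes "finite K" "keys m \<subseteq> K"
  shows "evm s m = (\<Prod>j\<in>K. s j ^ lookup m j)"
  unfolding evm_def
  by (rule prod.mono_neutral_left) (use assms in \<open>auto simp: in_keys_iff\<close>)

lemma evm_add: "evm s (m + m') = evm s m * evm s m'"
proof -
  let ?K = "keys m \<union> keys m'"
  have "keys (m + m') \<subseteq> ?K" by (rule keys_add)
  then show ?thesis
    by (simp add: evm_superset[of ?K] lookup_add power_add prod.distrib)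
qed

text \<open>Allows polynomials with different supports to be summed over one index set, as linearity
  requires.\<close>

lemma subst_superset:
  assumes "finite K" "keys f \<subseteq> K"
  shows "subst s f = (\<Sum>m\<in>K. Cst (lookup f m) * evm s m)"
  unfolding subst_def evm_def[symmetric]
  by (rule sum.mono_neutral_left) (use assms in \<open>auto simp: in_keys_iff\<close>)

lemma lin_subst: "lin (subst s)"
proof (rule linI)
  fix f h :: mpoly
  let ?K = "keys f \<union> keys h"
  have "keys (f + h) \<subseteq> ?K" by (rule keys_add)
  then show "subst s (f + h) = subst s f + subst s h"
    by (simp add: subst_superset[of ?K] lookup_add Cst_add distrib_right sum.distrib)
next
  fix c and f :: mpoly
  have "keys (Cst c * f) \<subseteq> keys f" by (auto simp: in_keys_iff)
  then show "subst s (Cst c * f) = Cst c * subst s f"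
    by (simp add: subst_superset[of "keys f"] Cst_mult sum_distrib_left mult.assoc)
qed

lemma subst_Mon: "subst s (Mon m) = evm s m"
  by (simp add: subst_superset[of "{m}"] lookup_Mon)

lemma subst_mult: "subst s (f * h) = subst s f * subst s h"
proof -
  have 1: "subst s (Mon m * h) = subst s (Mon m) * subst s h" for m h
    by (rule lin_eqI[where f = h])
       (auto intro: lin_compose lin_subst lin_mult simp: Mon_mult subst_Mon evm_add)
  show ?thesis
    by (rule lin_eqI[where f = f])
       (auto intro: lin_compose[where A = "subst s"] lin_compose[where B = "subst s"]
          lin_subst lin_mult_right simp: 1)
qed

lemma subst_1 [simp]: "subst s 1 = 1"
  using subst_Mon[of s 0] by (simp add: evm_def)

lemma subst_Cst [simp]: "subst s (Cst c) = Cst c"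
  using lin_scale[OF lin_subst, of s c 1] by simp

lemma subst_Var [simp]: "subst s (Var j) = s j"
  by (simp add: Var_eq_Mon subst_Mon evm_def)

lemmas subst_add = lin_add[OF lin_subst]
lemmas subst_diff = lin_diff[OF lin_subst]

lemma subst_power: "subst s (f ^ k) = subst s f ^ k"
  by (induction k) (simp_all add: subst_mult)

lemma subst_prod: "subst s (prod f S) = (\<Prod>x\<in>S. subst s (f x))"
  by (induction S rule: infinite_finite_induct) (simp_all add: subst_mult)

lemma subst_subst: "subst s (subst r f) = subst (\<lambda>j. subst s (r j)) f"
  by (rule lin_eqI[where f = f])
     (auto intro: lin_compose lin_subst simp: subst_Mon evm_def subst_prod subst_power)

lemma prod_Mon: "finite S \<Longrightarrow> (\<Prod>x\<in>S. Mon (e x)) = Mon (\<Sum>x\<in>S. e x)"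
  by (induction S rule: finite_induct) (simp_all add: Mon_mult)

lemma prod_Cst: "finite S \<Longrightarrow> (\<Prod>x\<in>S. Cst (e x)) = Cst (\<Prod>x\<in>S. e x)"
  by (induction S rule: finite_induct) (simp_all add: Cst_mult)

lemma lookup_map_key: "inj p \<Longrightarrow> lookup (map_key p m) j = lookup m (p j)"
  by (simp add: map_key.rep_eq)

text \<open>Treats the swaps and \<open>gop\<close> at once. The inverse q appears because the new
  exponent at i is the old exponent at q i.\<close>

lemma subst_scaled_Var_Mon:
  assumes pq: "\<And>j. p (q j) = j" and qp: "\<And>j. q (p j) = j"
  shows "subst (\<lambda>j. Cst (a j) * Var (p j)) (Mon m)
       = Cst (\<Prod>j\<in>keys m. a j ^ lookup m j) * Mon (map_key q m)"
proof -
  have inj: "inj q" by (metis injI pq)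
  have "lookup (\<Sum>j\<in>keys m. single (p j) (lookup m j)) i = lookup m (q i)" for i
  proof -
    have "lookup (\<Sum>j\<in>keys m. single (p j) (lookup m j)) i
        = (\<Sum>j\<in>keys m. if j = q i then lookup m j else 0)"
      unfolding lookup_sum by (rule sum.cong) (auto simp: lookup_single when_def pq qp)
    then show ?thesis by (simp add: in_keys_iff)
  qed
  then have "(\<Sum>j\<in>keys m. single (p j) (lookup m j)) = map_key q m"
    by (intro poly_mapping_eqI) (simp add: lookup_map_key inj)
  then show ?thesis
    by (simp add: subst_Mon evm_def power_mult_distrib prod.distrib Var_power prod_Mon
        prod_Cst flip: Cst_power)
qed

lemma subst_Var_id [simp]: "subst Var f = f"
proof (rule lin_eqI[where f = f, OF lin_subst lin_id])
  fix m
  show "subst Var (Mon m) = Mon m"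
    using subst_scaled_Var_Mon[of "\<lambda>j. j" "\<lambda>j. j" "\<lambda>_. 1" m] by (simp add: map_key_id)
qed

section \<open>Swaps of variables and divided differences\<close>

lemma lin_swp: "lin (swp i)"
  using lin_subst by (simp add: swp_def[abs_def])

lemma swp_swp [simp]: "swp i (swp i f) = f"
  by (simp add: swp_def subst_subst)

lemmas swp_add = lin_add[OF lin_swp]
lemmas swp_diff = lin_diff[OF lin_swp]

lemma swp_mult: "swp i (f * h) = swp i f * swp i h"
  by (simp add: swp_def subst_mult)

lemma swp_1 [simp]: "swp i 1 = 1"
  by (simp add: swp_def)

lemma swp_Cst [simp]: "swp i (Cst c) = Cst c"
  by (simp add: swp_def)

lemma swp_Var [simp]: "swp i (Var j) = Var (sw i j)"
  by (simp add: swp_def)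

lemma swp_Mon: "swp i (Mon m) = Mon (map_key (sw i) m)"
  using subst_scaled_Var_Mon[of "sw i" "sw i" "\<lambda>_. 1" m] by (simp add: swp_def)

lemma swp_braid: "swp i (swp (Suc i) (swp i f)) = swp (Suc i) (swp i (swp (Suc i) f))"
proof -
  have "(\<lambda>j. Var (sw i (sw (Suc i) (sw i j)))) = (\<lambda>j. Var (sw (Suc i) (sw i (sw (Suc i) j))))"
    using sw_braid[of i] by (simp add: fun_eq_iff)
  then show ?thesis by (simp add: swp_def subst_subst)
qed

lemma swp_far: "Suc i < j \<Longrightarrow> swp i (swp j f) = swp j (swp i f)"
  using sw_far_commute[of i j] by (simp add: swp_def subst_subst fun_eq_iff)

lemma Var_inject [simp]: "Var i = Var j \<longleftrightarrow> i = j"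
proof
  assume "Var i = Var j"
  then have "lookup (Var i) (single i 1) = lookup (Var j) (single i 1)" by simp
  then have "single j (1::nat) = single i 1"
    by (simp add: Var_eq_Mon lookup_Mon split: if_splits)
  then have "lookup (single j (1::nat)) i = 1" by simp
  then show "i = j" by (simp add: lookup_single when_def split: if_splits)
qed simp

lemma Cst_eq_0_iff [simp]: "Cst c = 0 \<longleftrightarrow> c = 0"
  by (metis Cst_def lookup_single_eq lookup_zero single_zero)

lemma dvd_diff_swp: "Var i - Var (Suc i) dvd f - swp i f"
proof -
  define D where "D f \<longleftrightarrow> Var i - Var (Suc i) dvd f - swp i f" for f
  have mult: "D (f * h)" if "D f" "D h" for f h
  proof -
    \<comment> \<open>The twisted Leibniz rule: divisibility passes to products, hence from
      variables to monomials.\<close>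
    have "f * h - swp i (f * h) = (f - swp i f) * h + swp i f * (h - swp i h)"
      by (simp add: swp_mult algebra_simps)
    then show ?thesis using that unfolding D_def by simp
  qed
  have "D 1" by (simp add: D_def)
  have "D (Var j)" for j
    using dvd_minus_iff[of "Var i - Var (Suc i)" "Var i - Var (Suc i)"]
    by (auto simp: D_def sw_def)
  then have "D (Var j ^ k)" for j k
    by (induction k) (auto intro: mult \<open>D 1\<close>)
  then have "D (\<Prod>j\<in>S. Var j ^ lookup m j)" for S m
    by (induction S rule: infinite_finite_induct) (auto intro: mult \<open>D 1\<close>)
  moreover have "Mon m = (\<Prod>j\<in>keys m. Var j ^ lookup m j)" for m
    using subst_Mon[of Var m] by (simp add: evm_def)
  ultimately have DM: "D (Mon m)" for m by metis
  have "f - swp i f = (\<Sum>m\<in>keys f. Cst (lookup f m) * (Mon m - swp i (Mon m)))"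
    by (rule lin_expand) (intro lin_minus lin_id lin_swp)
  then show ?thesis using DM unfolding D_def by (auto intro: dvd_sum)
qed

lemma divdiff_eqI:
  assumes "f - swp i f = (Var i - Var (Suc i)) * h"
  shows "divdiff i f = h"
  unfolding divdiff_def
  by (rule the_equality) (use assms in auto)

lemma divdiff: "(Var i - Var (Suc i)) * divdiff i f = f - swp i f"
proof -
  obtain h where "f - swp i f = (Var i - Var (Suc i)) * h"
    using dvd_diff_swp[of i f] by (auto elim: dvdE)
  then show ?thesis using divdiff_eqI by metis
qed

section \<open>Relations of the Demazure--Lusztig operators\<close>

lemma Var_diff_cancel:
  "i \<noteq> j \<Longrightarrow> (Var i - Var j) * f = (Var i - Var j) * h \<Longrightarrow> f = h"
  by simp

text \<open>The definition with its denominator cleared. Together with the converse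
  \<open>DL_eqI\<close> it reduces operator relations to polynomial identities.\<close>

lemma DL_mult: "(Var i - Var (Suc i)) * DL i f
    = (1 - Cst tt) * Var (Suc i) * f + (Cst tt * Var i - Var (Suc i)) * swp i f"
proof -
  have "(Var i - Var (Suc i)) * DL i f = Cst tt * (Var i - Var (Suc i)) * swp i f
     + Cst (1 - tt) * Var (Suc i) * ((Var i - Var (Suc i)) * divdiff i f)"
    by (simp add: DL_def algebra_simps)
  also have "\<dots> = (1 - Cst tt) * Var (Suc i) * f + (Cst tt * Var i - Var (Suc i)) * swp i f"
    unfolding divdiff by (simp add: Cst_diff algebra_simps)
  finally show ?thesis .
qed

lemma DL_eqI:
  assumes "(Var i - Var (Suc i)) * h
    = (1 - Cst tt) * Var (Suc i) * f + (Cst tt * Var i - Var (Suc i)) * swp i f"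
  shows "DL i f = h"
proof (rule Var_diff_cancel[of i "Suc i"])
  show "(Var i - Var (Suc i)) * DL i f = (Var i - Var (Suc i)) * h"
    by (simp only: DL_mult assms)
qed simp

lemma lin_DL: "lin (DL i)"
proof (rule linI)
  fix f h
  show "DL i (f + h) = DL i f + DL i h"
    by (rule DL_eqI) (simp only: distrib_left DL_mult swp_add, simp add: algebra_simps)
next
  fix c f
  show "DL i (Cst c * f) = Cst c * DL i f"
    by (rule DL_eqI)
       (simp only: mult.left_commute[of _ "Cst c"] DL_mult swp_mult swp_Cst,
        simp add: algebra_simps)
qed

text \<open>This is (T_i - t)(T_i + 1) = 0. It follows from \<open>DL_mult\<close> and its image
  under the swap, after multiplying twice by x_i - x_{i+1}.\<close>

lemma DL_quadratic: "DL i (DL i f) = Cst (tt - 1) * DL i f + Cst tt * f"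
proof (rule DL_eqI, rule Var_diff_cancel[of i "Suc i"])
  let ?X = "Var i" and ?Y = "Var (Suc i)" and ?t = "Cst tt" and ?d = "DL i f" and ?s = "swp i f"
  have 1: "(?X - ?Y) * ?d = (1 - ?t) * ?Y * f + (?t * ?X - ?Y) * ?s"
    by (rule DL_mult)
  have "swp i ((?X - ?Y) * ?d) = swp i ((1 - ?t) * ?Y * f + (?t * ?X - ?Y) * ?s)"
    by (simp only: 1)
  then have 2: "(?Y - ?X) * swp i ?d = (1 - ?t) * ?X * ?s + (?t * ?Y - ?X) * f"
    by (simp add: swp_add swp_diff swp_mult)
  show "(?X - ?Y) * ((?X - ?Y) * (Cst (tt - 1) * ?d + ?t * f)) =
    (?X - ?Y) * ((1 - ?t) * ?Y * ?d + (?t * ?X - ?Y) * swp i ?d)"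
    using 1 2 unfolding Cst_diff Cst_simps by algebra
qed simp

text \<open>The inverse of T_i as read off from the quadratic relation.\<close>

definition DLi :: "nat \<Rightarrow> mpoly \<Rightarrow> mpoly" where
  "DLi i f = Cst (inverse tt) * (DL i f - Cst (tt - 1) * f)"

lemma tt_neq_0 [simp]: "tt \<noteq> 0"
  by (simp add: tt_def Zero_fract_def eq_fract)

lemma qq_neq_0 [simp]: "qq \<noteq> 0"
  by (simp add: qq_def Zero_fract_def eq_fract)

lemma Cst_inverse_tt: "Cst (inverse tt) * (Cst tt * f) = f"
  by (simp flip: mult.assoc Cst_mult)

lemma DL_DLi: "DL i (DLi i f) = f"
  by (simp add: DLi_def lin_scale[OF lin_DL] lin_diff[OF lin_DL] DL_quadratic Cst_inverse_tt)

lemma DLi_DL: "DLi i (DL i f) = f"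
  by (simp add: DLi_def DL_quadratic Cst_inverse_tt)

lemma inv_DL: "inv (DL i) = DLi i"
  by (rule inv_equality) (rule DLi_DL DL_DLi)+

lemma lin_DLi: "lin (DLi i)"
  unfolding DLi_def[abs_def]
  by (intro lin_compose[OF lin_mult] lin_minus lin_DL lin_mult)

lemma DL_far:
  assumes "Suc i < j"
  shows "DL i (DL j f) = DL j (DL i f)"
proof (rule DL_eqI, rule Var_diff_cancel[of j "Suc j"])
  let ?X = "Var i" and ?Y = "Var (Suc i)" and ?U = "Var j" and ?V = "Var (Suc j)"
    and ?t = "Cst tt"
  have sw: "sw i j = j" "sw i (Suc j) = Suc j" "sw j i = i" "sw j (Suc i) = Suc i"
    using assms by (auto simp: sw_def)
  have 1: "(?X - ?Y) * DL i f = (1 - ?t) * ?Y * f + (?t * ?X - ?Y) * swp i f"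
    by (rule DL_mult)
  have "swp j ((?X - ?Y) * DL i f) = swp j ((1 - ?t) * ?Y * f + (?t * ?X - ?Y) * swp i f)"
    by (simp only: 1)
  then have 2: "(?X - ?Y) * swp j (DL i f) = (1 - ?t) * ?Y * swp j f + (?t * ?X - ?Y) * swp j (swp i f)"
    by (simp add: swp_add swp_diff swp_mult sw)
  have 3: "(?U - ?V) * DL j f = (1 - ?t) * ?V * f + (?t * ?U - ?V) * swp j f"
    by (rule DL_mult)
  have "swp i ((?U - ?V) * DL j f) = swp i ((1 - ?t) * ?V * f + (?t * ?U - ?V) * swp j f)"
    by (simp only: 3)
  then have 4: "(?U - ?V) * swp i (DL j f) = (1 - ?t) * ?V * swp i f + (?t * ?U - ?V) * swp i (swp j f)"
    by (simp add: swp_add swp_diff swp_mult sw)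
  have 5: "(?U - ?V) * DL j (DL i f) = (1 - ?t) * ?V * DL i f + (?t * ?U - ?V) * swp j (DL i f)"
    by (rule DL_mult)
  show "(?U - ?V) * ((?X - ?Y) * DL j (DL i f)) =
    (?U - ?V) * ((1 - ?t) * ?Y * DL j f + (?t * ?X - ?Y) * swp i (DL j f))"
    using 1 2 3 4 5 swp_far[OF assms, of f] by algebra
qed simp

text \<open>The digits record swaps: f21 is s_2 s_1 f, and s12a is s_1 s_2 a. In the first half a =
  T_1 f, b = T_2 a, c = T_1 b; in the primed half the roles of T_1 and T_2 are exchanged. Every
  equation is a permuted instance of \<open>DL_mult\<close>.\<close>

lemma DL_braid_field:
  fixes X Y Z t :: "'a::field"
  assumes ne: "X \<noteq> Y" "Y \<noteq> Z" "X \<noteq> Z"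
    and a: "(X - Y) * a = (1 - t) * Y * f + (t * X - Y) * f1"
    and s1a: "(Y - X) * s1a = (1 - t) * X * f1 + (t * Y - X) * f"
    and s2a: "(X - Z) * s2a = (1 - t) * Z * f2 + (t * X - Z) * f21"
    and s12a: "(Y - Z) * s12a = (1 - t) * Z * f12 + (t * Y - Z) * f121"
    and b: "(Y - Z) * b = (1 - t) * Z * a + (t * Y - Z) * s2a"
    and s1b: "(X - Z) * s1b = (1 - t) * Z * s1a + (t * X - Z) * s12a"
    and c: "(X - Y) * c = (1 - t) * Y * b + (t * X - Y) * s1b"
    and a': "(Y - Z) * a' = (1 - t) * Z * f + (t * Y - Z) * f2"
    and s2a': "(Z - Y) * s2a' = (1 - t) * Y * f2 + (t * Z - Y) * f"
    and s1a': "(X - Z) * s1a' = (1 - t) * Z * f1 + (t * X - Z) * f12"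
    and s21a': "(X - Y) * s21a' = (1 - t) * Y * f21 + (t * X - Y) * f121"
    and b': "(X - Y) * b' = (1 - t) * Y * a' + (t * X - Y) * s1a'"
    and s2b': "(X - Z) * s2b' = (1 - t) * Z * s2a' + (t * X - Z) * s21a'"
    and c': "(Y - Z) * c' = (1 - t) * Z * b' + (t * Y - Z) * s2b'"
  shows "c = c'"
proof -
  define A where "A x y = (1 - t) * y / (x - y)" for x y
  define B where "B x y = (t * x - y) / (x - y)" for x y
  have solve: "u = A x y * v + B x y * w"
    if "x \<noteq> y" "(x - y) * u = (1 - t) * y * v + (t * x - y) * w" for x y u v w
  proof -
    have "u = ((1 - t) * y * v + (t * x - y) * w) / (x - y)"
      using that by (metis nonzero_mult_div_cancel_left right_minus_eq)
    then show ?thesis by (simp add: A_def B_def add_divide_distrib)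
  qed
  \<comment> \<open>In the expansions over the six images of f, the coefficients of f21, f12 and
    f121 agree at once; these identities match those of f1, f2 and f.\<close>
  have 1: "A X Y * A Y Z + A X Z * A Y X = A Y Z * A X Z"
    using ne by (simp add: A_def divide_simps) (simp add: algebra_simps)
  have 2: "A X Y * A X Z = A Y Z * A X Y + A X Z * A Z Y"
    using ne by (simp add: A_def divide_simps) (simp add: algebra_simps)
  have 3: "A X Y * A Y Z * A X Y + B X Y * A X Z * B Y X
         = A Y Z * A X Y * A Y Z + B Y Z * A X Z * B Z Y"
    using ne by (simp add: A_def B_def divide_simps) (simp add: algebra_simps)
  note s = solve[OF _ a] solve[OF _ s1a] solve[OF _ s2a] solve[OF _ s12a] solve[OF _ b]
    solve[OF _ s1b] solve[OF _ c]
    solve[OF _ a'] solve[OF _ s2a'] solve[OF _ s1a'] solve[OF _ s21a'] solve[OF _ b']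
    solve[OF _ s2b'] solve[OF _ c']
  have "c = (A X Y * A Y Z * A X Y + B X Y * A X Z * B Y X) * f
    + B X Y * (A X Y * A Y Z + A X Z * A Y X) * f1 + A X Y * A X Z * B Y Z * f2
    + A X Y * B Y Z * B X Z * f21 + A Y Z * B X Y * B X Z * f12 + B X Y * B X Z * B Y Z * f121"
    using ne by (simp add: s algebra_simps)
  moreover have "c' = (A Y Z * A X Y * A Y Z + B Y Z * A X Z * B Z Y) * f
    + B X Y * (A Y Z * A X Z) * f1 + (A Y Z * A X Y + A X Z * A Z Y) * B Y Z * f2
    + A X Y * B Y Z * B X Z * f21 + A Y Z * B X Y * B X Z * f12 + B X Y * B X Z * B Y Z * f121"
    using ne by (simp add: s algebra_simps)
  ultimately show ?thesis by (simp only: 1 2 3)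
qed

lemma DL_braid: "DL i (DL (Suc i) (DL i f)) = DL (Suc i) (DL i (DL (Suc i) f))"
proof -
  \<comment> \<open>The embedding into the field of fractions, where T_i can be written as A + B
    s_i.\<close>
  define e :: "mpoly \<Rightarrow> mpoly fract" where "e = (\<lambda>f. Fract f 1)"
  have hom: "e (f + h) = e f + e h" "e (f - h) = e f - e h" "e (f * h) = e f * e h" "e 1 = 1"
    "e f = e h \<longleftrightarrow> f = h" for f h
    by (simp_all add: e_def eq_fract One_fract_def)
  let ?X = "Var i" and ?Y = "Var (Suc i)" and ?Z = "Var (Suc (Suc i))"
  let ?s1 = "swp i" and ?s2 = "swp (Suc i)" and ?T1 = "DL i" and ?T2 = "DL (Suc i)"
  have sw: "sw i (Suc (Suc i)) = Suc (Suc i)" "sw (Suc i) i = i"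
    by (simp_all add: sw_def)
  note dist = swp_add swp_diff swp_mult sw
  have 1: "(?X - ?Y) * ?T1 h = (1 - Cst tt) * ?Y * h + (Cst tt * ?X - ?Y) * ?s1 h" for h
    by (rule DL_mult)
  have 11: "(?Y - ?X) * ?s1 (?T1 h) = (1 - Cst tt) * ?X * ?s1 h + (Cst tt * ?Y - ?X) * h" for h
    using arg_cong[OF 1[of h], of ?s1] by (simp add: dist)
  have 12: "(?X - ?Z) * ?s2 (?T1 h)
      = (1 - Cst tt) * ?Z * ?s2 h + (Cst tt * ?X - ?Z) * ?s2 (?s1 h)" for h
    using arg_cong[OF 1[of h], of ?s2] by (simp add: dist)
  have 121: "(?Y - ?Z) * ?s1 (?s2 (?T1 h))
      = (1 - Cst tt) * ?Z * ?s1 (?s2 h) + (Cst tt * ?Y - ?Z) * ?s1 (?s2 (?s1 h))" for h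
    using arg_cong[OF 12[of h], of ?s1] by (simp add: dist)
  have 2: "(?Y - ?Z) * ?T2 h = (1 - Cst tt) * ?Z * h + (Cst tt * ?Y - ?Z) * ?s2 h" for h
    by (rule DL_mult)
  have 22: "(?Z - ?Y) * ?s2 (?T2 h) = (1 - Cst tt) * ?Y * ?s2 h + (Cst tt * ?Z - ?Y) * h" for h
    using arg_cong[OF 2[of h], of ?s2] by (simp add: dist)
  have 21: "(?X - ?Z) * ?s1 (?T2 h)
      = (1 - Cst tt) * ?Z * ?s1 h + (Cst tt * ?X - ?Z) * ?s1 (?s2 h)" for h
    using arg_cong[OF 2[of h], of ?s1] by (simp add: dist)
  have 212: "(?X - ?Y) * ?s2 (?s1 (?T2 h))
      = (1 - Cst tt) * ?Y * ?s2 (?s1 h) + (Cst tt * ?X - ?Y) * ?s1 (?s2 (?s1 h))" for h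
    using arg_cong[OF 21[of h], of ?s2] by (simp add: dist swp_braid)
  have E: "(e x - e y) * e u = (1 - e t) * e z * e v + (e t * e x' - e z') * e w"
    if "(x - y) * u = (1 - t) * z * v + (t * x' - z') * w" for x y u t z v x' z' w
    using arg_cong[OF that, of e] by (simp only: hom)
  have "e (?T1 (?T2 (?T1 f))) = e (?T2 (?T1 (?T2 f)))"
    by (rule DL_braid_field[OF _ _ _ E[OF 1] E[OF 11] E[OF 12] E[OF 121] E[OF 2] E[OF 21] E[OF 1]
          E[OF 2] E[OF 22] E[OF 21] E[OF 212] E[OF 1] E[OF 12] E[OF 2]])
       (simp_all add: hom)
  then show ?thesis by (simp add: hom)
qed

section \<open>Intertwining with the affine generator g\<close>

lemma subst_DL:
  assumes r: "r i = Cst c * Var k" "r (Suc i) = Cst c * Var (Suc k)" and "c \<noteq> 0"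
    and swp: "\<And>f. subst r (swp i f) = swp k (subst r f)"
  shows "subst r (DL i f) = DL k (subst r f)"
proof -
  \<comment> \<open>Both sides of \<open>DL_mult\<close> are of degree one in the pair of variables
    in its coefficients, so the common scalar c factors out and cancels.\<close>
  have "Cst c * ((Var k - Var (Suc k)) * subst r (DL i f))
      = subst r ((Var i - Var (Suc i)) * DL i f)"
    by (simp add: subst_mult subst_diff r algebra_simps)
  also have "\<dots> = Cst c * ((1 - Cst tt) * Var (Suc k) * subst r f
      + (Cst tt * Var k - Var (Suc k)) * swp k (subst r f))"
    unfolding DL_mult by (simp add: subst_mult subst_add subst_diff r swp algebra_simps)
  finally show ?thesis
    using \<open>c \<noteq> 0\<close> by (intro DL_eqI[symmetric]) simp
qed

lemma lin_gop: "lin (gop n)"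
  using lin_subst by (simp add: gop_def[abs_def])

lemma gop_DL:
  assumes "1 \<le> i" "Suc i < n"
  shows "gop n (DL i f) = DL (Suc i) (gop n f)"
  unfolding gop_def
proof (rule subst_DL[where c = 1])
  fix f
  show "subst (\<lambda>j. if 1 \<le> j \<and> j < n then Var (j + 1)
        else if j = n then Cst (inverse qq) * Var 1 else Var j) (swp i f) =
      swp (Suc i) (subst (\<lambda>j. if 1 \<le> j \<and> j < n then Var (j + 1)
        else if j = n then Cst (inverse qq) * Var 1 else Var j) f)"
    unfolding swp_def subst_subst
    by (rule arg_cong[where f = "\<lambda>s. subst s f"])
       (use assms in \<open>auto simp: fun_eq_iff sw_def subst_mult\<close>)
qed (use assms in auto)

lemma gop_gop_DL:
  assumes "2 \<le> n"
  shows "gop n (gop n (DL (n - 1) f)) = DL 1 (gop n (gop n f))"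
proof -
  let ?c = "Cst (inverse qq)"
  \<comment> \<open>The square of g. It sends x_{n-1}, x_n to q^{-1} x_1, q^{-1} x_2, a multiple of
    an adjacent pair, whereas g alone yields x_n and q^{-1} x_1.\<close>
  define r where "r j = (if 1 \<le> j \<and> j < n - 1 then Var (j + 2)
      else if j = n - 1 then ?c * Var 1 else if j = n then ?c * Var 2 else Var j)" for j
  have gg: "gop n (gop n f) = subst r f" for f
    unfolding gop_def subst_subst
    by (rule arg_cong[where f = "\<lambda>s. subst s f"])
       (use assms in \<open>auto simp: fun_eq_iff r_def subst_mult\<close>)
  show ?thesis unfolding gg
  proof (rule subst_DL[where c = "inverse qq"])
    fix f
    show "subst r (swp (n - 1) f) = swp 1 (subst r f)"
      unfolding swp_def subst_subst
      by (rule arg_cong[where f = "\<lambda>s. subst s f"])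
         (use assms in \<open>auto simp: fun_eq_iff r_def sw_def subst_mult\<close>)
  qed (use assms in \<open>auto simp: r_def numeral_2_eq_2\<close>)
qed

section \<open>Triangularity of the Cherednik operators\<close>

text \<open>The interior lattice points of the segment from m to its swap.\<close>

definition mid :: "nat \<Rightarrow> (nat \<Rightarrow>\<^sub>0 nat) \<Rightarrow> (nat \<Rightarrow>\<^sub>0 nat) set" where
  "mid k m = {m'. (\<forall>j. j \<noteq> k \<longrightarrow> j \<noteq> Suc k \<longrightarrow> lookup m' j = lookup m j)
     \<and> lookup m' k + lookup m' (Suc k) = lookup m k + lookup m (Suc k)
     \<and> min (lookup m k) (lookup m (Suc k)) < lookup m' k
     \<and> lookup m' k < max (lookup m k) (lookup m (Suc k))}"

text \<open>The sum over that interior when b has equal entries at k and k + 1 and d is the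
  difference of the entries of m there.\<close>

definition mids :: "nat \<Rightarrow> (nat \<Rightarrow>\<^sub>0 nat) \<Rightarrow> nat \<Rightarrow> mpoly" where
  "mids k b d = (\<Sum>i = 1..<d. Mon (b + single k i + single (Suc k) (d - i)))"

lemma Mon_plus_single: "Mon (b + single k d) = Mon b * Var k ^ d"
  by (simp add: Var_power Mon_mult)

text \<open>The monomial of b is symmetric in x_k and x_{k+1} and passes through T_k; the divided
  difference of a pure power is a geometric sum.\<close>

lemma
  assumes "lookup b k = lookup b (Suc k)"
  shows DL_Mon_balanced: "DL k (Mon b) = Cst tt * Mon b"
    and DL_Mon_right: "1 \<le> d \<Longrightarrow> DL k (Mon (b + single k d))
      = Mon (b + single (Suc k) d) + Cst (1 - tt) * mids k b d"
    and DL_Mon_left: "1 \<le> d \<Longrightarrow> DL k (Mon (b + single (Suc k) d))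
      = Cst tt * Mon (b + single k d) - Cst (1 - tt) * Mon (b + single (Suc k) d)
        - Cst (1 - tt) * mids k b d"
proof -
  let ?X = "Var k" and ?Y = "Var (Suc k)"
  define q where "q = (\<Sum>i<d. ?Y ^ (d - Suc i) * ?X ^ i)"
  have "map_key (sw k) b = b"
    by (rule poly_mapping_eqI) (use assms in \<open>simp add: lookup_map_key inj_sw sw_def\<close>)
  then have b: "swp k (Mon b) = Mon b" by (simp add: swp_Mon)
  have pow: "swp k (f ^ e) = swp k f ^ e" for f e
    by (induction e) (simp_all add: swp_mult)
  have dd: "divdiff k (Mon b * ?X ^ d) = Mon b * q"
  proof (rule divdiff_eqI)
    have "?X ^ d - ?Y ^ d = (?X - ?Y) * q"
      unfolding q_def by (rule power_diff_sumr2)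
    then show "Mon b * ?X ^ d - swp k (Mon b * ?X ^ d) = (?X - ?Y) * (Mon b * q)"
      by (simp add: swp_mult b pow mult.left_commute flip: right_diff_distrib)
  qed
  have dd': "divdiff k (Mon b * ?Y ^ d) = - (Mon b * q)"
  proof (rule divdiff_eqI)
    have "?X ^ d - ?Y ^ d = (?X - ?Y) * q"
      unfolding q_def by (rule power_diff_sumr2)
    then have "?Y ^ d - ?X ^ d = (?X - ?Y) * - q"
      by (metis minus_diff_eq mult_minus_right)
    then show "Mon b * ?Y ^ d - swp k (Mon b * ?Y ^ d) = (?X - ?Y) * - (Mon b * q)"
      by (simp add: swp_mult b pow mult.left_commute flip: right_diff_distrib)
  qed
  \<comment> \<open>The summand i = 0 is an endpoint of the segment and is split off; the others are
    interior.\<close>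
  have Yq: "?Y * (Mon b * q) = Mon (b + single (Suc k) d) + mids k b d" if "1 \<le> d"
  proof -
    have "?Y * q = (\<Sum>i<d. ?Y ^ (d - i) * ?X ^ i)"
      unfolding q_def sum_distrib_left
    proof (rule sum.cong)
      fix i assume "i \<in> {..<d}"
      then have "d - i = Suc (d - Suc i)" by auto
      then show "?Y * (?Y ^ (d - Suc i) * ?X ^ i) = ?Y ^ (d - i) * ?X ^ i" by (simp add: mult.assoc)
    qed simp
    also have "{..<d} = insert 0 {1..<d}" using that by auto
    also have "(\<Sum>i\<in>\<dots>. ?Y ^ (d - i) * ?X ^ i) = ?Y ^ d + (\<Sum>i = 1..<d. ?Y ^ (d - i) * ?X ^ i)"
      by simp
    finally have "Mon b * (?Y * q) = Mon b * ?Y ^ d + (\<Sum>i = 1..<d. Mon b * (?Y ^ (d - i) * ?X ^ i))"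
      by (simp add: distrib_left sum_distrib_left)
    then show ?thesis
      by (simp add: mids_def Mon_plus_single mult_ac)
  qed
  show "DL k (Mon b) = Cst tt * Mon b"
    using divdiff_eqI[of "Mon b" k 0] by (simp add: DL_def b)
  show "DL k (Mon (b + single k d)) = Mon (b + single (Suc k) d) + Cst (1 - tt) * mids k b d"
    if "1 \<le> d"
  proof -
    have "DL k (Mon (b + single k d))
        = Cst tt * Mon (b + single (Suc k) d) + Cst (1 - tt) * (?Y * (Mon b * q))"
      by (simp add: DL_def Mon_plus_single dd swp_mult b pow mult.assoc)
    then show ?thesis unfolding Yq[OF that] by (simp add: Cst_diff algebra_simps)
  qed
  show "DL k (Mon (b + single (Suc k) d))
      = Cst tt * Mon (b + single k d) - Cst (1 - tt) * Mon (b + single (Suc k) d)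
        - Cst (1 - tt) * mids k b d"
    if "1 \<le> d"
  proof -
    have "DL k (Mon (b + single (Suc k) d))
        = Cst tt * Mon (b + single k d) - Cst (1 - tt) * (?Y * (Mon b * q))"
      by (simp add: DL_def Mon_plus_single dd' swp_mult b pow mult.assoc)
    then show ?thesis unfolding Yq[OF that] by (simp add: Cst_diff algebra_simps)
  qed
qed

lemma DL_Mon_eq:
  assumes "lookup m k = lookup m (Suc k)"
  shows "DL k (Mon m) = Cst tt * Mon (map_key (sw k) m)"
proof -
  have "map_key (sw k) m = m"
    by (rule poly_mapping_eqI) (use assms in \<open>simp add: lookup_map_key inj_sw sw_def\<close>)
  then show ?thesis using DL_Mon_balanced[OF assms] by simp
qed

lemma DL_Mon_gt:
  assumes "lookup m (Suc k) < lookup m k"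
  shows "\<exists>h. keys h \<subseteq> mid k m
    \<and> DL k (Mon m) = Mon (map_key (sw k) m) + Cst (1 - tt) * h"
proof -
  define d where "d = lookup m k - lookup m (Suc k)"
  define b where "b = m - single k d"
  have lb: "lookup b j = (if j = k then lookup m (Suc k) else lookup m j)" for j
    using assms by (simp add: b_def d_def lookup_minus lookup_single when_def)
  have m: "m = b + single k d"
    by (rule poly_mapping_eqI)
       (use assms in \<open>auto simp: lookup_add lookup_single when_def lb d_def\<close>)
  have m': "map_key (sw k) m = b + single (Suc k) d"
    by (rule poly_mapping_eqI)
       (use assms in \<open>auto simp: lookup_add lookup_single when_def lb d_def lookup_map_key inj_sw sw_def\<close>)
  have "keys (mids k b d) \<subseteq> (\<Union>i\<in>{1..<d}. keys (Mon (b + single k i + single (Suc k) (d - i))))"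
    unfolding mids_def by (rule keys_sum)
  also have "\<dots> \<subseteq> mid k m"
    using assms by (auto simp: mid_def lookup_add lookup_single when_def lb d_def)
  finally have "keys (mids k b d) \<subseteq> mid k m" .
  moreover have "DL k (Mon m) = Mon (map_key (sw k) m) + Cst (1 - tt) * mids k b d"
    unfolding m' unfolding m by (rule DL_Mon_right) (use assms in \<open>simp_all add: lb d_def\<close>)
  ultimately show ?thesis by blast
qed

text \<open>Unlike in \<open>DL_Mon_gt\<close>, the monomial of m itself survives here. The twisted
  rank has to make it a lower term.\<close>

lemma DL_Mon_lt:
  assumes "lookup m k < lookup m (Suc k)"
  shows "\<exists>h. keys h \<subseteq> mid k m
    \<and> DL k (Mon m) = Cst tt * Mon (map_key (sw k) m) - Cst (1 - tt) * Mon m - Cst (1 - tt) * h"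
proof -
  define d where "d = lookup m (Suc k) - lookup m k"
  define b where "b = m - single (Suc k) d"
  have lb: "lookup b j = (if j = Suc k then lookup m k else lookup m j)" for j
    using assms by (simp add: b_def d_def lookup_minus lookup_single when_def)
  have m: "m = b + single (Suc k) d"
    by (rule poly_mapping_eqI)
       (use assms in \<open>auto simp: lookup_add lookup_single when_def lb d_def\<close>)
  have m': "map_key (sw k) m = b + single k d"
    by (rule poly_mapping_eqI)
       (use assms in \<open>auto simp: lookup_add lookup_single when_def lb d_def lookup_map_key inj_sw sw_def\<close>)
  have "keys (mids k b d) \<subseteq> (\<Union>i\<in>{1..<d}. keys (Mon (b + single k i + single (Suc k) (d - i))))"
    unfolding mids_def by (rule keys_sum)
  also have "\<dots> \<subseteq> mid k m"
    using assms by (auto simp: mid_def lookup_add lookup_single when_def lb d_def)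
  finally have "keys (mids k b d) \<subseteq> mid k m" .
  moreover have "DL k (Mon m)
      = Cst tt * Mon (map_key (sw k) m) - Cst (1 - tt) * Mon m - Cst (1 - tt) * mids k b d"
    unfolding m' unfolding m by (rule DL_Mon_left) (use assms in \<open>simp_all add: lb d_def\<close>)
  ultimately show ?thesis by blast
qed

text \<open>
  Twisting the linear part of the order by \<open>w\<close> makes a single \<open>T\<^sub>k\<close> triangular: it is a filtered
  map from the \<open>w\<close>-order to the \<open>w s\<^sub>k\<close>-order if \<open>w k < w (k + 1)\<close>, and \<open>T\<^sub>k\<^sup>-\<^sup>1\<close> is one if
  \<open>w k > w (k + 1)\<close>. Along the factors of \<open>Y\<^sub>j\<close> the twist runs from \<open>id\<close> back to \<open>id\<close>.
\<close>

definition rk :: "nat \<Rightarrow> (nat \<Rightarrow> nat) \<Rightarrow> (nat \<Rightarrow>\<^sub>0 nat) \<Rightarrow> nat \<times> nat" where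
  "rk n w m = (\<Sum>j\<in>{1..n}. (lookup m j)\<^sup>2, \<Sum>j\<in>{1..n}. w j * lookup m j)"

text \<open>Moving exponent and twist together keeps the rank, so leading monomials never change
  rank along the factors of Y_j.\<close>

lemma rk_permute:
  assumes "p permutes {1..n}"
  shows "rk n (w \<circ> p) (map_key p m) = rk n w m"
  using sum.permute[OF assms, of "\<lambda>j. (lookup m j)\<^sup>2"]
    sum.permute[OF assms, of "\<lambda>j. w j * lookup m j"]
  by (simp add: rk_def lookup_map_key permutes_inj[OF assms] o_def)

lemma sum_split_pair:
  fixes f :: "nat \<Rightarrow> nat"
  assumes "1 \<le> k" "k < n"
  shows "(\<Sum>j\<in>{1..n}. f j) = f k + f (Suc k) + (\<Sum>j\<in>{1..n} - {k, Suc k}. f j)"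
proof -
  have "{1..n} = insert k (insert (Suc k) ({1..n} - {k, Suc k}))" using assms by auto
  then have "sum f {1..n} = sum f (insert k (insert (Suc k) ({1..n} - {k, Suc k})))" by simp
  also have "\<dots> = f k + f (Suc k) + (\<Sum>j\<in>{1..n} - {k, Suc k}. f j)"
    by (subst sum.insert; simp)+
  finally show ?thesis .
qed

text \<open>Convexity: with a = c + u and d = a + v the difference of the two sides is 2uv.\<close>

lemma sum_squares_less:
  fixes a b c d :: nat
  assumes "a + b = c + d" "min c d < a" "a < max c d"
  shows "a\<^sup>2 + b\<^sup>2 < c\<^sup>2 + d\<^sup>2"
proof -
  have *: "a\<^sup>2 + b\<^sup>2 < c\<^sup>2 + d\<^sup>2" if "a + b = c + d" "c < a" "a < d" for a b c d :: nat
  proof -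
    obtain u where u: "a = c + u" "u > 0" using \<open>c < a\<close> less_imp_add_positive by blast
    obtain v where v: "d = a + v" "v > 0" using \<open>a < d\<close> less_imp_add_positive by blast
    have b: "b = c + v" using u v that(1) by simp
    have "0 < 2 * (u * v)" using u v by simp
    then show ?thesis unfolding v b u by (simp add: power2_eq_square algebra_simps)
  qed
  show ?thesis
  proof (cases "c \<le> d")
    case True
    then show ?thesis using *[of a b c d] assms by simp
  next
    case False
    then show ?thesis using *[of a b d c] assms by simp
  qed
qed

text \<open>Interior points lower the sum of squares, the first component of the rank; hence the two
  twists may be arbitrary.\<close>

lemma rk_mid:
  assumes "1 \<le> k" "k < n" "keys m \<subseteq> {1..n}" "m' \<in> mid k m"
  shows "keys m' \<subseteq> {1..n}" "rk n w' m' < rk n w m"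
proof -
  show "keys m' \<subseteq> {1..n}"
  proof
    fix j assume j: "j \<in> keys m'"
    show "j \<in> {1..n}"
    proof (cases "j = k \<or> j = Suc k")
      case True
      then show ?thesis using assms by auto
    next
      case False
      then have "j \<in> keys m" using j assms(4) by (auto simp: mid_def in_keys_iff)
      then show ?thesis using assms by auto
    qed
  qed
  have "(lookup m' k)\<^sup>2 + (lookup m' (Suc k))\<^sup>2 < (lookup m k)\<^sup>2 + (lookup m (Suc k))\<^sup>2"
    using assms(4) by (intro sum_squares_less) (auto simp: mid_def)
  moreover have "(\<Sum>j\<in>{1..n} - {k, Suc k}. (lookup m' j)\<^sup>2) = (\<Sum>j\<in>{1..n} - {k, Suc k}. (lookup m j)\<^sup>2)"
    by (rule sum.cong) (use assms(4) in \<open>auto simp: mid_def\<close>)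
  ultimately show "rk n w' m' < rk n w m"
    unfolding rk_def less_prod_simp sum_split_pair[OF assms(1,2)] by simp
qed

text \<open>The rearrangement inequality for the linear component; the sum of squares is the same on
  both sides.\<close>

lemma rk_swap_less:
  assumes "1 \<le> k" "k < n"
    and "w k < w (Suc k) \<and> lookup m k < lookup m (Suc k)
      \<or> w (Suc k) < w k \<and> lookup m (Suc k) < lookup m k"
  shows "rk n (w \<circ> sw k) m < rk n w m"
proof -
  have *: "b * x + a * y < a * x + b * y" if "a < b" "x < y" for a b x y :: nat
  proof -
    obtain u where u: "b = a + u" "u > 0" using \<open>a < b\<close> less_imp_add_positive by blast
    obtain v where v: "y = x + v" "v > 0" using \<open>x < y\<close> less_imp_add_positive by blast
    show ?thesis using u(2) v(2) unfolding u(1) v(1) by (simp add: algebra_simps)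
  qed
  have "w (Suc k) * lookup m k + w k * lookup m (Suc k)
      < w k * lookup m k + w (Suc k) * lookup m (Suc k)"
    using assms(3) *[of "w k" "w (Suc k)" "lookup m k" "lookup m (Suc k)"]
      *[of "w (Suc k)" "w k" "lookup m (Suc k)" "lookup m k"] by auto
  moreover have "(\<Sum>j\<in>{1..n} - {k, Suc k}. (w \<circ> sw k) j * lookup m j)
      = (\<Sum>j\<in>{1..n} - {k, Suc k}. w j * lookup m j)"
    by (rule sum.cong) (auto simp: sw_other)
  ultimately have "(\<Sum>j\<in>{1..n}. (w \<circ> sw k) j * lookup m j) < (\<Sum>j\<in>{1..n}. w j * lookup m j)"
    unfolding sum_split_pair[OF assms(1,2)] by simp
  then show ?thesis by (simp add: rk_def)
qed

text \<open>The strict bound makes \<open>Fil n w (rk n w m)\<close> the space of terms below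
  m.\<close>

definition Fil :: "nat \<Rightarrow> (nat \<Rightarrow> nat) \<Rightarrow> nat \<times> nat \<Rightarrow> mpoly set" where
  "Fil n w r = {v. \<forall>m\<in>keys v. keys m \<subseteq> {1..n} \<and> rk n w m < r}"

lemma Fil_0 [simp]: "0 \<in> Fil n w r"
  by (simp add: Fil_def)

lemma Fil_add: "u \<in> Fil n w r \<Longrightarrow> v \<in> Fil n w r \<Longrightarrow> u + v \<in> Fil n w r"
  unfolding Fil_def using keys_add[of u v] by blast

lemma Fil_diff: "u \<in> Fil n w r \<Longrightarrow> v \<in> Fil n w r \<Longrightarrow> u - v \<in> Fil n w r"
  unfolding Fil_def using keys_diff[of u v] by blast

lemma keys_Cst_mult: "keys (Cst c * v) \<subseteq> keys v"
  by (auto simp: in_keys_iff)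

lemma Fil_scale: "v \<in> Fil n w r \<Longrightarrow> Cst c * v \<in> Fil n w r"
  unfolding Fil_def using keys_Cst_mult[of c v] by blast

lemma Fil_sum: "(\<And>x. x \<in> S \<Longrightarrow> v x \<in> Fil n w r) \<Longrightarrow> sum v S \<in> Fil n w r"
  by (induction S rule: infinite_finite_induct) (auto intro: Fil_add)

lemma Fil_mono: "v \<in> Fil n w r \<Longrightarrow> r \<le> r' \<Longrightarrow> v \<in> Fil n w r'"
  by (force simp: Fil_def)

lemma Fil_Mon: "Mon m \<in> Fil n w r \<longleftrightarrow> keys m \<subseteq> {1..n} \<and> rk n w m < r"
  by (simp add: Fil_def)

lemma lin_Fil:
  assumes "lin A" "v \<in> Fil n w r"
    and "\<And>m. keys m \<subseteq> {1..n} \<Longrightarrow> rk n w m < r \<Longrightarrow> A (Mon m) \<in> Fil n w' r'"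
  shows "A v \<in> Fil n w' r'"
  unfolding lin_expand[OF assms(1), of v]
  by (intro Fil_sum Fil_scale assms(3)) (use assms(2) in \<open>auto simp: Fil_def\<close>)

lemma Fil_mid:
  assumes "1 \<le> k" "k < n" "keys m \<subseteq> {1..n}" "keys h \<subseteq> mid k m"
  shows "h \<in> Fil n w' (rk n w m)"
  unfolding Fil_def using rk_mid[OF assms(1-3)] assms(4) by blast

text \<open>Interior terms are lower for any twist. The surviving monomial of m occurs only if its
  entry at k is the smaller one, and there \<open>rk_swap_less\<close> applies because of w k < w (k
  + 1).\<close>

lemma DL_Fil:
  assumes "1 \<le> k" "k < n" "w k < w (Suc k)" "keys m \<subseteq> {1..n}"
  shows "DL k (Mon m)
    - Cst (if lookup m (Suc k) < lookup m k then 1 else tt) * Mon (map_key (sw k) m)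
    \<in> Fil n (w \<circ> sw k) (rk n w m)"
proof (cases "lookup m k" "lookup m (Suc k)" rule: linorder_cases)
  case less
  then obtain h where h: "keys h \<subseteq> mid k m"
    "DL k (Mon m) = Cst tt * Mon (map_key (sw k) m) - Cst (1 - tt) * Mon m - Cst (1 - tt) * h"
    using DL_Mon_lt by blast
  have "Mon m \<in> Fil n (w \<circ> sw k) (rk n w m)"
    using rk_swap_less[OF assms(1,2), of w m] less assms by (simp add: Fil_Mon)
  then have "0 - Cst (1 - tt) * Mon m - Cst (1 - tt) * h \<in> Fil n (w \<circ> sw k) (rk n w m)"
    using Fil_mid[OF assms(1,2,4) h(1)] by (intro Fil_scale Fil_diff) auto
  then show ?thesis using less by (simp add: h(2))
next
  case equal
  then show ?thesis by (simp add: DL_Mon_eq)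
next
  case greater
  then obtain h where h: "keys h \<subseteq> mid k m"
    "DL k (Mon m) = Mon (map_key (sw k) m) + Cst (1 - tt) * h"
    using DL_Mon_gt by blast
  then show ?thesis
    using greater Fil_mid[OF assms(1,2,4) h(1)] by (simp add: Fil_scale)
qed

text \<open>For the inverse the surviving monomial cancels when the entry at k is the smaller one
  and appears when it is the larger one, so the condition on w is reversed.\<close>

lemma DLi_Fil:
  assumes "1 \<le> k" "k < n" "w (Suc k) < w k" "keys m \<subseteq> {1..n}"
  shows "DLi k (Mon m)
    - Cst (if lookup m (Suc k) \<le> lookup m k then inverse tt else 1) * Mon (map_key (sw k) m)
    \<in> Fil n (w \<circ> sw k) (rk n w m)"
proof (cases "lookup m k" "lookup m (Suc k)" rule: linorder_cases)
  case less
  then obtain h where h: "keys h \<subseteq> mid k m"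
    "DL k (Mon m) = Cst tt * Mon (map_key (sw k) m) - Cst (1 - tt) * Mon m - Cst (1 - tt) * h"
    using DL_Mon_lt by blast
  have "DLi k (Mon m) = Mon (map_key (sw k) m) - Cst (inverse tt) * (Cst (1 - tt) * h)"
  proof -
    have "DL k (Mon m) - Cst (tt - 1) * Mon m = Cst tt * Mon (map_key (sw k) m) - Cst (1 - tt) * h"
      unfolding h(2) by (simp add: Cst_diff algebra_simps)
    then show ?thesis
      unfolding DLi_def by (simp only: right_diff_distrib Cst_inverse_tt)
  qed
  moreover have "0 - Cst (inverse tt) * (Cst (1 - tt) * h) \<in> Fil n (w \<circ> sw k) (rk n w m)"
    using Fil_mid[OF assms(1,2,4) h(1)] by (intro Fil_scale Fil_diff) auto
  ultimately show ?thesis using less by simp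
next
  case equal
  have "map_key (sw k) m = m"
    by (rule poly_mapping_eqI) (use equal in \<open>simp add: lookup_map_key inj_sw sw_def\<close>)
  then have "DL k (Mon m) - Cst (tt - 1) * Mon m = Mon m"
    by (simp add: DL_Mon_eq[OF equal] Cst_diff algebra_simps)
  then show ?thesis using equal \<open>map_key (sw k) m = m\<close> by (simp add: DLi_def)
next
  case greater
  then obtain h where h: "keys h \<subseteq> mid k m"
    "DL k (Mon m) = Mon (map_key (sw k) m) + Cst (1 - tt) * h"
    using DL_Mon_gt by blast
  have "Mon m \<in> Fil n (w \<circ> sw k) (rk n w m)"
    using rk_swap_less[OF assms(1,2), of w m] greater assms by (simp add: Fil_Mon)
  then have "Cst (inverse tt) * (Cst (1 - tt) * (h + Mon m)) \<in> Fil n (w \<circ> sw k) (rk n w m)"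
    using Fil_mid[OF assms(1,2,4) h(1)] by (intro Fil_scale Fil_add) auto
  moreover have "DLi k (Mon m) - Cst (inverse tt) * Mon (map_key (sw k) m)
      = Cst (inverse tt) * (Cst (1 - tt) * (h + Mon m))"
    unfolding DLi_def h(2) by (simp add: Cst_diff algebra_simps)
  ultimately show ?thesis using greater by simp
qed

text \<open>The bound stays at the rank of a under the identity twist, which by
  \<open>rk_permute\<close> is also the rank of the moved leading monomial under w.\<close>

definition lead :: "nat \<Rightarrow> (nat \<Rightarrow> nat) \<Rightarrow> (nat \<Rightarrow>\<^sub>0 nat) \<Rightarrow> qt \<Rightarrow> mpoly \<Rightarrow> bool" where
  "lead n w a c v \<longleftrightarrow> v - Cst c * Mon (map_key w a) \<in> Fil n w (rk n id a)"

lemma lead_step: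
  assumes A: "lin A"
    and tri: "\<And>m. keys m \<subseteq> {1..n} \<Longrightarrow>
      A (Mon m) - Cst (e m) * Mon (map_key p m) \<in> Fil n (w \<circ> p) (rk n w m)"
    and p: "p permutes {1..n}" and w: "w permutes {1..n}" and a: "keys a \<subseteq> {1..n}"
    and v: "lead n w a c v"
  shows "lead n (w \<circ> p) a (c * e (map_key w a)) (A v)"
proof -
  have inj: "inj p" "inj w" using p w permutes_inj by auto
  have perm_keys: "keys (map_key q m) \<subseteq> {1..n}" if "keys m \<subseteq> {1..n}" "q permutes {1..n}" for q m
    using that permutes_in_image[OF that(2)] by (auto simp: keys_map_key permutes_inj)
  \<comment> \<open>Lower terms stay lower, since the leading term of the image of each monomial
    keeps its rank.\<close>
  have Fil: "A u \<in> Fil n (w \<circ> p) r" if "u \<in> Fil n w r" for u r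
  proof (rule lin_Fil[OF A that])
    fix m assume m: "keys m \<subseteq> {1..n}" "rk n w m < r"
    have "Mon (map_key p m) \<in> Fil n (w \<circ> p) r"
      using m perm_keys[OF m(1) p] by (simp add: Fil_Mon rk_permute[OF p])
    then have "(A (Mon m) - Cst (e m) * Mon (map_key p m)) + Cst (e m) * Mon (map_key p m)
        \<in> Fil n (w \<circ> p) r"
      using Fil_mono[OF tri[OF m(1)]] m(2) by (intro Fil_add Fil_scale) auto
    then show "A (Mon m) \<in> Fil n (w \<circ> p) r" by simp
  qed
  let ?m = "map_key w a" and ?r = "rk n id a"
  have r: "rk n w ?m = ?r" using rk_permute[OF w, of id a] by simp
  have km: "keys ?m \<subseteq> {1..n}" using perm_keys[OF a w] .
  have "A (v - Cst c * Mon ?m) + Cst c * (A (Mon ?m) - Cst (e ?m) * Mon (map_key p ?m))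
      \<in> Fil n (w \<circ> p) ?r"
    using Fil v tri[OF km] unfolding lead_def r by (intro Fil_add Fil_scale) auto
  also have "A (v - Cst c * Mon ?m) + Cst c * (A (Mon ?m) - Cst (e ?m) * Mon (map_key p ?m))
      = A v - Cst (c * e ?m) * Mon (map_key (w \<circ> p) a)"
    by (simp add: lin_diff[OF A] lin_scale[OF A] Cst_mult map_key_compose inj algebra_simps)
  finally show ?thesis unfolding lead_def .
qed

text \<open>
  In one-line notation, \<open>wup j n\<close> is \<open>[1, ..., j - 1, j + 1, ..., n, j]\<close> and \<open>wdn j 1\<close> is
  \<open>[j, 1, ..., j - 1, j + 1, ..., n]\<close>: the twists reached just before and just after applying \<open>g\<close>.
\<close>

definition wup :: "nat \<Rightarrow> nat \<Rightarrow> nat \<Rightarrow> nat" where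
  "wup j l i = (if i < j then i else if i < l then Suc i else if i = l then j else i)"

definition wdn :: "nat \<Rightarrow> nat \<Rightarrow> nat \<Rightarrow> nat" where
  "wdn j l i = (if i < l then i else if i = l then j else if i \<le> j then i - 1 else i)"

text \<open>The inverse of the shift of variables under g, because \<open>map_key\<close> reads old
  exponents.\<close>

definition cyc :: "nat \<Rightarrow> nat \<Rightarrow> nat" where
  "cyc n i = (if i = 1 then n else if 1 < i \<and> i \<le> n then i - 1 else i)"

lemma wup_step: "j \<le> l \<Longrightarrow> wup j l \<circ> sw l = wup j (Suc l)"
  by (auto simp: fun_eq_iff wup_def sw_def)

lemma wdn_step: "l < j \<Longrightarrow> wdn j l \<circ> sw l = wdn j (Suc l)"
  by (auto simp: fun_eq_iff wdn_def sw_def)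

lemma wup_refl: "wup j j = id"
  by (auto simp: fun_eq_iff wup_def)

lemma wdn_refl: "wdn j j = id"
  by (auto simp: fun_eq_iff wdn_def)

lemma wup_cyc: "1 \<le> j \<Longrightarrow> j \<le> n \<Longrightarrow> wup j n \<circ> cyc n = wdn j 1"
  by (auto simp: fun_eq_iff wup_def wdn_def cyc_def)

lemma cyc_permutes:
  assumes "1 \<le> n"
  shows "cyc n permutes {1..n}"
proof (rule bij_imp_permutes)
  show "bij_betw (cyc n) {1..n} {1..n}"
    by (rule bij_betw_byWitness[where f' = "\<lambda>i. if i = n then 1 else Suc i"])
       (use assms in \<open>auto simp: cyc_def\<close>)
qed (use assms in \<open>auto simp: cyc_def\<close>)

lemma gop_Mon:
  assumes "1 \<le> n"
  shows "gop n (Mon m) = Cst (inverse qq ^ lookup m n) * Mon (map_key (cyc n) m)"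
proof -
  define p where "p j = (if 1 \<le> j \<and> j < n then Suc j else if j = n then 1 else j)" for j
  define a where "a j = (if j = n then inverse qq else 1)" for j
  have "gop n (Mon m) = subst (\<lambda>j. Cst (a j) * Var (p j)) (Mon m)"
    unfolding gop_def
    by (rule arg_cong[where f = "\<lambda>s. subst s (Mon m)"])
       (use assms in \<open>auto simp: fun_eq_iff a_def p_def\<close>)
  also have "\<dots> = Cst (\<Prod>j\<in>keys m. a j ^ lookup m j) * Mon (map_key (cyc n) m)"
    by (rule subst_scaled_Var_Mon) (use assms in \<open>auto simp: p_def cyc_def\<close>)
  also have "(\<Prod>j\<in>keys m. a j ^ lookup m j)
      = (\<Prod>j\<in>keys m. if j = n then inverse qq ^ lookup m n else 1)"
    by (rule prod.cong) (auto simp: a_def)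
  also have "\<dots> = inverse qq ^ lookup m n"
    by (simp add: in_keys_iff)
  finally show ?thesis .
qed

text \<open>The eigenvalue of Y_j prescribed for E_a, with the exponent vector a in place of a
  list.\<close>

definition zeta :: "nat \<Rightarrow> (nat \<Rightarrow>\<^sub>0 nat) \<Rightarrow> nat \<Rightarrow> qt" where
  "zeta n a j = inverse qq ^ lookup a j
     * tt ^ (card {m. 1 \<le> m \<and> m < j \<and> lookup a m > lookup a j}
           + card {m. j < m \<and> m \<le> n \<and> lookup a m \<ge> lookup a j})"

text \<open>At twist \<open>wup j l\<close> the entry a_j sits at position l. T_l compares it with
  a_{l+1} and contributes t exactly if a_{l+1} >= a_j.\<close>

lemma lead_up:
  assumes "1 \<le> j" "j \<le> l" "l \<le> n" "keys a \<subseteq> {1..n}"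
  shows "wup j l permutes {1..n} \<and>
    lead n (wup j l) a (tt ^ card {m. j < m \<and> m \<le> l \<and> lookup a m \<ge> lookup a j})
      (fold DL [j..<l] (Mon a))"
  using assms(2,3)
proof (induction l rule: dec_induct)
  case base
  have "{m. j < m \<and> m \<le> j \<and> lookup a m \<ge> lookup a j} = {}" by auto
  then have c: "tt ^ card {m. j < m \<and> m \<le> j \<and> lookup a m \<ge> lookup a j} = 1"
    by (simp only: card.empty power_0)
  show ?case unfolding c
    by (simp add: wup_refl lead_def permutes_id[unfolded id_def] map_key_id id_def)
next
  case (step l)
  let ?c = "\<lambda>l. card {m. j < m \<and> m \<le> l \<and> lookup a m \<ge> lookup a j}"
  have l: "1 \<le> l" "l < n" using step.hyps step.prems assms by auto
  have w: "wup j l l = j" "wup j l (Suc l) = Suc l"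
    using step.hyps step.prems by (auto simp: wup_def)
  have perm: "wup j l permutes {1..n}"
    using step.IH step.hyps step.prems by linarith
  have leadl: "lead n (wup j l) a (tt ^ ?c l) (fold DL [j..<l] (Mon a))"
    using step.IH step.prems by linarith
  have "lead n (wup j l \<circ> sw l) a (tt ^ ?c l * (if lookup (map_key (wup j l) a) (Suc l)
      < lookup (map_key (wup j l) a) l then 1 else tt)) (DL l (fold DL [j..<l] (Mon a)))"
    by (rule lead_step[OF lin_DL DL_Fil sw_permutes perm assms(4) leadl])
       (use l w step.hyps in simp_all)
  moreover have "lookup (map_key (wup j l) a) (Suc l) = lookup a (Suc l)"
    "lookup (map_key (wup j l) a) l = lookup a j"
    using step.hyps step.prems by (simp_all add: lookup_map_key permutes_inj[OF perm] w)
  moreover have "tt ^ ?c l * (if lookup a (Suc l) < lookup a j then 1 else tt) = tt ^ ?c (Suc l)"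
  proof (cases "lookup a (Suc l) < lookup a j")
    case True
    then have "{m. j < m \<and> m \<le> Suc l \<and> lookup a m \<ge> lookup a j}
        = {m. j < m \<and> m \<le> l \<and> lookup a m \<ge> lookup a j}"
      by (auto simp: le_Suc_eq)
    then show ?thesis using True by simp
  next
    case False
    then have "{m. j < m \<and> m \<le> Suc l \<and> lookup a m \<ge> lookup a j}
        = insert (Suc l) {m. j < m \<and> m \<le> l \<and> lookup a m \<ge> lookup a j}"
      using step.hyps step.prems by (auto simp: le_Suc_eq)
    then show ?thesis using False by simp
  qed
  moreover have "wup j (Suc l) permutes {1..n}"
    using permutes_compose[OF sw_permutes[OF l] perm] step.hyps step.prems by (simp add: wup_step)
  ultimately show ?case using step.hyps step.prems by (simp add: wup_step)
qed

text \<open>At twist \<open>wdn j l\<close> the entries a_j and a_l sit at positions l and l + 1,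
  and the inverse of T_l contributes t^{-1} exactly if a_l <= a_j.\<close>

lemma lead_down:
  assumes "1 \<le> l" "l \<le> j" "j \<le> n" "keys a \<subseteq> {1..n}"
    and "wdn j 1 permutes {1..n}" "lead n (wdn j 1) a c v"
  shows "wdn j l permutes {1..n} \<and>
    lead n (wdn j l) a (c * inverse tt ^ card {m. 1 \<le> m \<and> m < l \<and> lookup a m \<le> lookup a j})
      (fold DLi [1..<l] v)"
  using assms(1,2)
proof (induction l rule: dec_induct)
  case base
  have "{m::nat. 1 \<le> m \<and> m < 1 \<and> lookup a m \<le> lookup a j} = {}" by auto
  then have c: "inverse tt ^ card {m. 1 \<le> m \<and> m < 1 \<and> lookup a m \<le> lookup a j} = 1"
    by (simp only: card.empty power_0)
  show ?case unfolding c using assms by simp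
next
  case (step l)
  let ?c = "\<lambda>l. card {m. 1 \<le> m \<and> m < l \<and> lookup a m \<le> lookup a j}"
  have l: "1 \<le> l" "l < n" using step.hyps step.prems assms by auto
  have w: "wdn j l l = j" "wdn j l (Suc l) = l"
    using step.hyps step.prems by (auto simp: wdn_def)
  have perm: "wdn j l permutes {1..n}"
    using step.IH step.hyps step.prems by linarith
  have leadl: "lead n (wdn j l) a (c * inverse tt ^ ?c l) (fold DLi [1..<l] v)"
    using step.IH step.prems by linarith
  have "lead n (wdn j l \<circ> sw l) a (c * inverse tt ^ ?c l * (if lookup (map_key (wdn j l) a) (Suc l)
      \<le> lookup (map_key (wdn j l) a) l then inverse tt else 1)) (DLi l (fold DLi [1..<l] v))"
    by (rule lead_step[OF lin_DLi DLi_Fil sw_permutes perm assms(4) leadl])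
       (use l w step.prems in simp_all)
  moreover have "lookup (map_key (wdn j l) a) (Suc l) = lookup a l"
    "lookup (map_key (wdn j l) a) l = lookup a j"
    using step.hyps step.prems by (simp_all add: lookup_map_key permutes_inj[OF perm] w)
  moreover have "inverse tt ^ ?c l * (if lookup a l \<le> lookup a j then inverse tt else 1)
      = inverse tt ^ ?c (Suc l)"
  proof (cases "lookup a l \<le> lookup a j")
    case True
    then have "{m. 1 \<le> m \<and> m < Suc l \<and> lookup a m \<le> lookup a j}
        = insert l {m. 1 \<le> m \<and> m < l \<and> lookup a m \<le> lookup a j}"
      using l by auto
    then show ?thesis using True by simp
  next
    case False
    then have "{m. 1 \<le> m \<and> m < Suc l \<and> lookup a m \<le> lookup a j}
        = {m. 1 \<le> m \<and> m < l \<and> lookup a m \<le> lookup a j}"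
      by (auto simp: less_Suc_eq)
    then show ?thesis using False by simp
  qed
  moreover have "wdn j (Suc l) permutes {1..n}"
    using permutes_compose[OF sw_permutes[OF l] perm] step.hyps step.prems by (simp add: wdn_step)
  ultimately show ?case using step.hyps step.prems by (simp add: wdn_step mult.assoc)
qed

lemma Yop_eq: "Yop n j f = Cst (tt ^ (j - 1)) * fold DLi [1..<j] (gop n (fold DL [j..<n] f))"
  by (simp add: Yop_def inv_DL)

lemma Yop_Mon:
  assumes j: "1 \<le> j" "j \<le> n" and a: "keys a \<subseteq> {1..n}"
  shows "Yop n j (Mon a) - Cst (zeta n a j) * Mon a \<in> Fil n id (rk n id a)"
proof -
  let ?c1 = "card {m. j < m \<and> m \<le> n \<and> lookup a m \<ge> lookup a j}"
  let ?c2 = "card {m. 1 \<le> m \<and> m < j \<and> lookup a m \<le> lookup a j}"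
  let ?c3 = "card {m. 1 \<le> m \<and> m < j \<and> lookup a m > lookup a j}"
  have perm: "wup j n permutes {1..n}"
    and up: "lead n (wup j n) a (tt ^ ?c1) (fold DL [j..<n] (Mon a))"
    using lead_up[OF j(1) j(2) order_refl a] by auto
  have "lead n (wup j n \<circ> cyc n) a (tt ^ ?c1 * inverse qq ^ lookup (map_key (wup j n) a) n)
      (gop n (fold DL [j..<n] (Mon a)))"
    by (rule lead_step[OF lin_gop _ cyc_permutes perm a up]) (use j in \<open>simp_all add: gop_Mon\<close>)
  moreover have "lookup (map_key (wup j n) a) n = lookup a j"
    using j by (simp add: lookup_map_key permutes_inj[OF perm] wup_def)
  moreover have "wdn j 1 permutes {1..n}"
    using permutes_compose[OF cyc_permutes perm] j by (simp add: wup_cyc)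
  ultimately have "lead n (wdn j j) a (tt ^ ?c1 * inverse qq ^ lookup a j * inverse tt ^ ?c2)
      (fold DLi [1..<j] (gop n (fold DL [j..<n] (Mon a))))" (is "lead _ _ _ ?c ?v")
    using lead_down[OF j(1) order_refl j(2) a] j by (simp add: wup_cyc)
  then have "Cst (tt ^ (j - 1)) * (?v - Cst ?c * Mon a) \<in> Fil n id (rk n id a)"
    unfolding lead_def wdn_refl by (intro Fil_scale) (simp add: id_def map_key_id)
  \<comment> \<open>The j - 1 positions left of j split by a_m <= a_j or a_m > a_j; the first kind
    cancels the inverse powers and the second kind remains.\<close>
  moreover have "tt ^ (j - 1) * ?c = zeta n a j"
  proof -
    let ?A = "{m. 1 \<le> m \<and> m < j \<and> lookup a m \<le> lookup a j}"
      and ?B = "{m. 1 \<le> m \<and> m < j \<and> lookup a m > lookup a j}"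
    have "{1..<j} = ?A \<union> ?B" by auto
    then have "card {1..<j} = card (?A \<union> ?B)" by (rule arg_cong)
    also have "\<dots> = ?c2 + ?c3"
      by (rule card_Un_disjoint) (auto intro: finite_subset[of _ "{..<j}"])
    finally have "j - 1 = ?c2 + ?c3" by simp
    then show ?thesis
      by (simp add: zeta_def power_add power_inverse field_simps)
  qed
  ultimately show ?thesis
    by (simp add: Yop_eq right_diff_distrib flip: mult.assoc Cst_mult)
qed

lemma lin_fold: "(\<And>i. lin (A i)) \<Longrightarrow> lin (fold A xs)"
  by (induction xs) (auto simp: lin_id id_def o_def intro: lin_compose)

lemma lin_Yop: "lin (Yop n j)"
  unfolding Yop_eq[abs_def]
  by (intro lin_compose[OF lin_mult] lin_compose[OF lin_fold] lin_compose[OF lin_gop] lin_fold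
      lin_DL lin_DLi)

section \<open>Nonsymmetric Macdonald polynomials\<close>

interpretation hecke: affine_braid n DL DLi "gop n" for n
proof
  show "DL i (DLi i f) = f" "DLi i (DL i f) = f" for i f
    by (rule DL_DLi DLi_DL)+
  show "DL i (DL (Suc i) (DL i f)) = DL (Suc i) (DL i (DL (Suc i) f))" for i f
    by (rule DL_braid)
  show "DL i (DL j f) = DL j (DL i f)" if "Suc i < j" for i j f
    using that by (rule DL_far)
  show "gop n (DL i f) = DL (Suc i) (gop n f)" if "1 \<le> i" "Suc i < n" for i f
    using that by (rule gop_DL)
  show "gop n (gop n (DL (n - 1) f)) = DL 1 (gop n (gop n f))" if "2 \<le> n" for f
    using that by (rule gop_gop_DL)
qed

lemma Yop_Z: "Yop n j f = Cst (tt ^ (j - 1)) * hecke.Z n j f"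
  by (simp add: Yop_eq hecke.Z_def hecke.up_def hecke.down_def)

lemma lin_Z: "lin (hecke.Z n j)"
  unfolding hecke.Z_def[abs_def] hecke.up_def hecke.down_def
  by (intro lin_compose[OF lin_fold] lin_compose[OF lin_gop] lin_fold lin_DL lin_DLi)

lemma Yop_commute:
  assumes "j \<in> {1..n}" "k \<in> {1..n}"
  shows "Yop n j (Yop n k f) = Yop n k (Yop n j f)"
proof -
  have "hecke.Z n j (hecke.Z n k f) = hecke.Z n k (hecke.Z n j f)"
    using assms by (intro hecke.Z_commute) auto
  then show ?thesis
    unfolding Yop_Z lin_scale[OF lin_Z] by (simp only: mult.left_commute)
qed

lemma Yop_DL_commute:
  assumes "j \<in> {1..n}" "1 \<le> k" "k < n" "j \<noteq> k" "j \<noteq> Suc k"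
  shows "Yop n j (DL k f) = DL k (Yop n j f)"
  using assms by (simp add: Yop_Z lin_scale[OF lin_DL] hecke.Z_T_commute)

text \<open>The factor t is the ratio of the normalising powers in Y_{k+1} and Y_k.\<close>

lemma Yop_conj:
  assumes "1 \<le> k" "k < n"
  shows "DL k (Yop n (Suc k) (DL k f)) = Cst tt * Yop n k f"
proof -
  have "tt ^ k = tt * tt ^ (k - 1)" using assms by (cases k) auto
  then show ?thesis
    using hecke.Z_conj[of k n f] assms
    by (simp add: Yop_Z lin_scale[OF lin_DL] Cst_mult mult.assoc)
qed

lemma Yop_Fil:
  assumes "j \<in> {1..n}" "v \<in> Fil n id r"
  shows "Yop n j v \<in> Fil n id r"
proof (rule lin_Fil[OF lin_Yop assms(2)])
  fix m assume m: "keys m \<subseteq> {1..n}" "rk n id m < r"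
  have "(Yop n j (Mon m) - Cst (zeta n m j) * Mon m) + Cst (zeta n m j) * Mon m \<in> Fil n id r"
    using Fil_mono[OF Yop_Mon[of j n m]] m assms(1)
    by (intro Fil_add Fil_scale) (auto simp: Fil_Mon)
  then show "Yop n j (Mon m) \<in> Fil n id r" by simp
qed

section \<open>Separation of eigenvalues\<close>

lemma qq_tt_power: "qq ^ a * tt ^ b = Fract (monom (monom 1 a) b) 1"
proof -
  have pow: "Fract p 1 ^ k = Fract (p ^ k) 1" for p :: "rat poly poly" and k
    by (induction k) (simp_all add: One_fract_def)
  have "[:[:0, 1::rat:]:] ^ a * [:0, 1:] ^ b = monom (monom 1 a) b"
    by (simp add: poly_const_pow monom_altdef)
  then show ?thesis by (simp add: qq_def tt_def pow)
qed

lemma qq_tt_independent: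
  assumes "inverse qq ^ a * tt ^ b = inverse qq ^ c * tt ^ d"
  shows "a = c" "b = d"
proof -
  have "qq ^ c * tt ^ b = qq ^ a * tt ^ d"
    using assms by (simp add: field_simps)
  then have "monom (monom (1::rat) c) b = monom (monom 1 a) d"
    by (simp add: qq_tt_power eq_fract)
  then show "a = c" "b = d"
    by (auto simp: monom_eq_iff')
qed

text \<open>The power of q alone recovers the entry, so equality of all eigenvalues forces equality
  of exponents.\<close>

lemma zeta_eqD:
  assumes "zeta n m j = zeta n m' j'"
  shows "lookup m j = lookup m' j'"
  using qq_tt_independent(1) assms unfolding zeta_def by blast

lemma exponent_eqI:
  assumes "keys m \<subseteq> {1..n}" "keys m' \<subseteq> {1..n}" "\<And>j. j \<in> {1..n} \<Longrightarrow> lookup m j = lookup m' j"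
  shows "m = m'"
proof (rule poly_mapping_eqI)
  fix j
  show "lookup m j = lookup m' j"
  proof (cases "j \<in> {1..n}")
    case False
    then have "j \<notin> keys m" "j \<notin> keys m'" using assms(1,2) by blast+
    then show ?thesis by (simp add: in_keys_iff)
  qed (rule assms(3))
qed

text \<open>The sum of squares bounds every entry, since an entry is at most its square.\<close>

lemma finite_rk_less: "finite {m. keys m \<subseteq> {1..n} \<and> rk n w m < r}"
proof (rule finite_subset)
  let ?S = "PiE {1..n} (\<lambda>_. {..fst r})"
  let ?f = "\<lambda>f :: nat \<Rightarrow> nat. \<Sum>j\<in>{1..n}. single j (f j)"
  show "finite (?f ` ?S)" by (intro finite_imageI finite_PiE) auto
  show "{m. keys m \<subseteq> {1..n} \<and> rk n w m < r} \<subseteq> ?f ` ?S"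
  proof
    fix m assume "m \<in> {m. keys m \<subseteq> {1..n} \<and> rk n w m < r}"
    then have m: "keys m \<subseteq> {1..n}" "rk n w m < r" by auto
    have "lookup m j \<le> fst r" if "j \<in> {1..n}" for j
    proof -
      have "lookup m j \<le> (lookup m j)\<^sup>2" by (simp add: power2_nat_le_imp_le)
      also have "\<dots> \<le> (\<Sum>j\<in>{1..n}. (lookup m j)\<^sup>2)"
        using that by (intro member_le_sum) auto
      also have "\<dots> \<le> fst r" using m(2) by (auto simp: rk_def less_prod_def)
      finally show ?thesis .
    qed
    then have "restrict (lookup m) {1..n} \<in> ?S" by auto
    moreover have "m = ?f (restrict (lookup m) {1..n})"
    proof (rule poly_mapping_eqI)
      fix i
      have "lookup (?f (restrict (lookup m) {1..n})) i
          = (\<Sum>j\<in>{1..n}. if j = i then lookup m j else 0)"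
        unfolding lookup_sum by (rule sum.cong) (auto simp: lookup_single when_def)
      also have "\<dots> = lookup m i" using m(1) by (auto simp: in_keys_iff)
      finally show "lookup m i = lookup (?f (restrict (lookup m) {1..n})) i" ..
    qed
    ultimately show "m \<in> ?f ` ?S" by blast
  qed
qed

lemma finite_obtains_max:
  fixes f :: "'a \<Rightarrow> 'b::linorder"
  assumes "finite S" "S \<noteq> {}"
  obtains x where "x \<in> S" "\<And>y. y \<in> S \<Longrightarrow> f y \<le> f x"
proof -
  have "Max (f ` S) \<in> f ` S" using assms by (intro Max_in) auto
  then obtain x where "x \<in> S" "f x = Max (f ` S)" by auto
  then show ?thesis using assms by (intro that[of x]) auto
qed

lemma Fil_lookup: "v \<in> Fil n w r \<Longrightarrow> \<not> rk n w m < r \<Longrightarrow> lookup v m = 0"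
  by (auto simp: Fil_def in_keys_iff)

text \<open>
  \<open>P\<close> is a product of factors \<open>Y\<^sub>j - \<zeta>\<^sub>j(b)\<close> over \<open>b \<in> L\<close> in order of decreasing rank, where \<open>j\<close> depends
  on \<open>b\<close> and separates \<open>b\<close> from \<open>a\<close>; each factor removes its \<open>b\<close> from the support. As the \<open>Y\<^sub>j\<close>
  commute, \<open>P\<close> maps the monomial of \<open>a\<close> to an eigenvector when \<open>L\<close> is everything below \<open>a\<close>.
\<close>

lemma annihilator:
  assumes a: "keys a \<subseteq> {1..n}"
    and "finite L" "\<And>m. m \<in> L \<Longrightarrow> keys m \<subseteq> {1..n} \<and> rk n id m < rk n id a"
    and "\<And>m m'. m \<in> L \<Longrightarrow> keys m' \<subseteq> {1..n} \<Longrightarrow> rk n id m' < rk n id m \<Longrightarrow> m' \<in> L"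
  shows "\<exists>P c. lin P \<and> (\<forall>j\<in>{1..n}. \<forall>f. P (Yop n j f) = Yop n j (P f)) \<and>
    (\<forall>v. keys v \<subseteq> L \<longrightarrow> P v = 0) \<and> c \<noteq> 0 \<and>
    (\<forall>v\<in>Fil n id (rk n id a). P v \<in> Fil n id (rk n id a)) \<and>
    P (Mon a) - Cst c * Mon a \<in> Fil n id (rk n id a)" (is "?ex L")
  using assms(2-)
proof (induction "card L" arbitrary: L)
  case 0
  then have "L = {}" by simp
  then show ?case
    by (intro exI[of _ "\<lambda>f. f"] exI[of _ 1]) (auto simp: lin_id)
next
  case (Suc N)
  let ?F = "Fil n id (rk n id a)"
  have "L \<noteq> {}" using Suc.hyps(2) by auto
  then obtain b where b: "b \<in> L" "\<And>m. m \<in> L \<Longrightarrow> rk n id m \<le> rk n id b"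
    using finite_obtains_max[of L "rk n id"] Suc.prems(1) by metis
  have kb: "keys b \<subseteq> {1..n}" "rk n id b < rk n id a" using Suc.prems(2) b(1) by auto
  let ?L = "L - {b}"
  have "?ex ?L"
  proof (rule Suc.hyps(1))
    show "N = card ?L" using Suc.hyps(2) b(1) Suc.prems(1) by simp
    show "finite ?L" using Suc.prems(1) by simp
    show "keys m \<subseteq> {1..n} \<and> rk n id m < rk n id a" if "m \<in> ?L" for m
      using that Suc.prems(2) by blast
    \<comment> \<open>Removing an element of top rank keeps the set closed under passing to smaller
      rank.\<close>
    show "m' \<in> ?L" if "m \<in> ?L" "keys m' \<subseteq> {1..n}" "rk n id m' < rk n id m" for m m'
      using that Suc.prems(3)[of m m'] b(2)[of m] by auto
  qed
  then obtain P c where P: "lin P"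
      "\<And>j f. j \<in> {1..n} \<Longrightarrow> P (Yop n j f) = Yop n j (P f)"
      "\<And>v. keys v \<subseteq> ?L \<Longrightarrow> P v = 0" "c \<noteq> 0" "\<And>v. v \<in> ?F \<Longrightarrow> P v \<in> ?F"
      "P (Mon a) - Cst c * Mon a \<in> ?F"
    by blast
  obtain j where j: "j \<in> {1..n}" "zeta n a j \<noteq> zeta n b j"
  proof -
    have "b \<noteq> a" using kb by auto
    then obtain j where "j \<in> {1..n}" "lookup a j \<noteq> lookup b j"
      using exponent_eqI[OF a kb(1)] by auto
    then show ?thesis using that zeta_eqD by blast
  qed
  define A where "A f = Yop n j f - Cst (zeta n b j) * f" for f
  have A: "lin A"
    unfolding A_def[abs_def] by (intro lin_minus lin_Yop lin_mult)
  have A_Mon: "A (Mon m) = (Yop n j (Mon m) - Cst (zeta n m j) * Mon m)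
      + Cst (zeta n m j - zeta n b j) * Mon m" for m
    by (simp add: A_def Cst_diff algebra_simps)
  \<comment> \<open>Lower terms rank strictly below b, so b could only arise from its own diagonal
    term, whose coefficient is zero.\<close>
  have keys_A: "keys (A (Mon m)) \<subseteq> ?L" if "m \<in> L" for m
  proof
    fix x assume x: "x \<in> keys (A (Mon m))"
    have m: "keys m \<subseteq> {1..n}" "rk n id m \<le> rk n id b" using Suc.prems(2) b that by auto
    have Y: "Yop n j (Mon m) - Cst (zeta n m j) * Mon m \<in> Fil n id (rk n id m)"
      using Yop_Mon j m by auto
    consider "x \<in> keys (Yop n j (Mon m) - Cst (zeta n m j) * Mon m)"
      | "x \<in> keys (Cst (zeta n m j - zeta n b j) * Mon m)"
      using x keys_add[of "Yop n j (Mon m) - Cst (zeta n m j) * Mon m"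
          "Cst (zeta n m j - zeta n b j) * Mon m"]
      unfolding A_Mon by blast
    then show "x \<in> ?L"
    proof cases
      case 1
      then have "keys x \<subseteq> {1..n}" "rk n id x < rk n id m" using Y by (auto simp: Fil_def)
      then show ?thesis using Suc.prems(3)[OF that] m(2) by auto
    next
      case 2
      then have "x = m" "m \<noteq> b" by (auto simp: in_keys_iff lookup_Mon split: if_splits)
      then show ?thesis using that by simp
    qed
  qed
  have FA: "A v \<in> ?F" if "v \<in> ?F" for v
    unfolding A_def using that j(1) by (intro Fil_diff Fil_scale Yop_Fil)
  show ?case
  proof (intro exI conjI ballI allI impI)
    show "lin (\<lambda>f. P (A f))" by (rule lin_compose[OF P(1) A])
    show "P (A (Yop n k f)) = Yop n k (P (A f))" if "k \<in> {1..n}" for k f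
    proof -
      have "A (Yop n k f) = Yop n k (A f)"
        using Yop_commute[OF j(1) that]
        by (simp add: A_def lin_diff[OF lin_Yop] lin_scale[OF lin_Yop])
      then show ?thesis using P(2) that by simp
    qed
    show "P (A v) = 0" if v: "keys v \<subseteq> L" for v
    proof (rule P(3))
      have "keys (A v) \<subseteq> (\<Union>m\<in>keys v. keys (Cst (lookup v m) * A (Mon m)))"
        by (subst lin_expand[OF A]) (rule keys_sum)
      also have "\<dots> \<subseteq> ?L" using keys_A v keys_Cst_mult by blast
      finally show "keys (A v) \<subseteq> ?L" .
    qed
    show "c * (zeta n a j - zeta n b j) \<noteq> 0" using P(4) j(2) by simp
    show "P (A v) \<in> ?F" if "v \<in> ?F" for v using P(5) FA that by simp
    have "P (Yop n j (Mon a) - Cst (zeta n a j) * Mon a)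
        + Cst (zeta n a j - zeta n b j) * (P (Mon a) - Cst c * Mon a) \<in> ?F"
      using P(5)[OF Yop_Mon] P(6) j(1) a by (intro Fil_add Fil_scale) auto
    also have "P (Yop n j (Mon a) - Cst (zeta n a j) * Mon a)
        + Cst (zeta n a j - zeta n b j) * (P (Mon a) - Cst c * Mon a)
      = P (A (Mon a)) - Cst (c * (zeta n a j - zeta n b j)) * Mon a"
      unfolding A_Mon lin_add[OF P(1)] lin_scale[OF P(1)] Cst_mult
      by (simp only: right_diff_distrib) (simp add: mult_ac)
    finally show "P (A (Mon a)) - Cst (c * (zeta n a j - zeta n b j)) * Mon a \<in> ?F" .
  qed
qed

section \<open>Joint eigenvectors\<close>

lemma in_vars_Fil: "v \<in> Fil n w r \<Longrightarrow> in_vars n v"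
  by (simp add: Fil_def in_vars_def)

lemma in_vars_add: "in_vars n u \<Longrightarrow> in_vars n v \<Longrightarrow> in_vars n (u + v)"
  unfolding in_vars_def using keys_add[of u v] by blast

lemma in_vars_diff: "in_vars n u \<Longrightarrow> in_vars n v \<Longrightarrow> in_vars n (u - v)"
  unfolding in_vars_def using keys_diff[of u v] by blast

lemma in_vars_scale: "in_vars n v \<Longrightarrow> in_vars n (Cst c * v)"
  unfolding in_vars_def using keys_Cst_mult[of c v] by blast

lemma in_vars_Mon: "in_vars n (Mon m) \<longleftrightarrow> keys m \<subseteq> {1..n}"
  by (simp add: in_vars_def)

lemma in_vars_sum: "(\<And>x. x \<in> S \<Longrightarrow> in_vars n (v x)) \<Longrightarrow> in_vars n (sum v S)"
  by (induction S rule: infinite_finite_induct) (auto intro: in_vars_add simp: in_vars_def[of n 0])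

lemma in_vars_DL:
  assumes "1 \<le> k" "k < n" "in_vars n v"
  shows "in_vars n (DL k v)"
  unfolding lin_expand[OF lin_DL, of k v]
proof (intro in_vars_sum in_vars_scale)
  fix m assume "m \<in> keys v"
  then have m: "keys m \<subseteq> {1..n}" using assms by (auto simp: in_vars_def)
  let ?c = "if lookup m (Suc k) < lookup m k then 1 else tt"
  have "keys (map_key (sw k) m) \<subseteq> {1..n}"
    using m permutes_in_image[OF sw_permutes[OF assms(1,2)]] by (auto simp: keys_map_key inj_sw)
  then have "in_vars n ((DL k (Mon m) - Cst ?c * Mon (map_key (sw k) m))
      + Cst ?c * Mon (map_key (sw k) m))"
    using in_vars_Fil[OF DL_Fil[OF assms(1,2), of id m]] m
    by (intro in_vars_add in_vars_scale) (auto simp: in_vars_Mon)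
  then show "in_vars n (DL k (Mon m))" by simp
qed

definition eigen :: "nat \<Rightarrow> (nat \<Rightarrow> qt) \<Rightarrow> mpoly \<Rightarrow> bool" where
  "eigen n l v \<longleftrightarrow> in_vars n v \<and> (\<forall>j\<in>{1..n}. Yop n j v = Cst (l j) * v)"

lemma eigen_exists:
  assumes a: "keys a \<subseteq> {1..n}"
  shows "\<exists>E. eigen n (zeta n a) E \<and> lookup E a = 1"
proof -
  let ?L = "{m. keys m \<subseteq> {1..n} \<and> rk n id m < rk n id a}"
  let ?F = "Fil n id (rk n id a)"
  have "\<exists>P c. lin P \<and> (\<forall>j\<in>{1..n}. \<forall>f. P (Yop n j f) = Yop n j (P f)) \<and>
    (\<forall>v. keys v \<subseteq> ?L \<longrightarrow> P v = 0) \<and> c \<noteq> 0 \<and>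
    (\<forall>v\<in>?F. P v \<in> ?F) \<and> P (Mon a) - Cst c * Mon a \<in> ?F"
    by (rule annihilator[OF a finite_rk_less]) auto
  then obtain P c where P: "lin P"
      "\<And>j f. j \<in> {1..n} \<Longrightarrow> P (Yop n j f) = Yop n j (P f)"
      "\<And>v. keys v \<subseteq> ?L \<Longrightarrow> P v = 0" "c \<noteq> 0" "P (Mon a) - Cst c * Mon a \<in> ?F"
    by blast
  let ?E = "P (Mon a)"
  have "in_vars n ((?E - Cst c * Mon a) + Cst c * Mon a)"
    using in_vars_Fil[OF P(5)] a by (intro in_vars_add in_vars_scale) (auto simp: in_vars_Mon)
  then have iv: "in_vars n ?E" by simp
  have ev: "Yop n j ?E = Cst (zeta n a j) * ?E" if "j \<in> {1..n}" for j
  proof -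
    \<comment> \<open>By triangularity the argument is supported below a, where P vanishes.\<close>
    have "P (Yop n j (Mon a) - Cst (zeta n a j) * Mon a) = 0"
      using Yop_Mon[of j n a] that a by (intro P(3)) (auto simp: Fil_def)
    then show ?thesis
      using that by (simp add: lin_diff[OF P(1)] lin_scale[OF P(1)] P(2))
  qed
  have "lookup (?E - Cst c * Mon a) a = 0"
    by (rule Fil_lookup[OF P(5)]) simp
  then have "lookup ?E a = c" by (simp add: lookup_minus lookup_Mon)
  then have "eigen n (zeta n a) (Cst (inverse c) * ?E) \<and> lookup (Cst (inverse c) * ?E) a = 1"
    using iv ev P(4)
    by (simp add: eigen_def in_vars_scale lin_scale[OF lin_Yop] mult.left_commute)
  then show ?thesis by blast
qed

text \<open>Take m of maximal rank in the support and compare coefficients at m. Ties in rank do no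
  harm, because the lower terms of each monomial have strictly smaller rank.\<close>

lemma eigen_key:
  assumes "eigen n l v" "v \<noteq> 0"
  obtains m where "m \<in> keys v" "keys m \<subseteq> {1..n}" "\<And>j. j \<in> {1..n} \<Longrightarrow> l j = zeta n m j"
proof -
  have iv: "\<And>m. m \<in> keys v \<Longrightarrow> keys m \<subseteq> {1..n}"
    using assms(1) by (auto simp: eigen_def in_vars_def)
  have "keys v \<noteq> {}" using assms(2) by simp
  then obtain m where m: "m \<in> keys v" "\<And>x. x \<in> keys v \<Longrightarrow> rk n id x \<le> rk n id m"
    using finite_obtains_max[of "keys v" "rk n id"] finite_keys by metis
  have "l j = zeta n m j" if j: "j \<in> {1..n}" for j
  proof -
    have *: "lookup (Yop n j (Mon x)) m = (if x = m then zeta n m j else 0)" if "x \<in> keys v" for x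
    proof -
      have "Yop n j (Mon x) - Cst (zeta n x j) * Mon x \<in> Fil n id (rk n id x)"
        using Yop_Mon j iv[OF that] by auto
      then have "lookup (Yop n j (Mon x) - Cst (zeta n x j) * Mon x) m = 0"
        by (rule Fil_lookup) (use m(2)[OF that] in \<open>simp add: not_less\<close>)
      then show ?thesis by (auto simp: lookup_minus lookup_Mon)
    qed
    have "lookup (Yop n j v) m = (\<Sum>x\<in>keys v. lookup v x * lookup (Yop n j (Mon x)) m)"
      unfolding lin_expand[OF lin_Yop, of n j v] lookup_sum by simp
    also have "\<dots> = (\<Sum>x\<in>keys v. if x = m then lookup v m * zeta n m j else 0)"
      by (rule sum.cong) (auto simp: *)
    also have "\<dots> = lookup v m * zeta n m j" using m(1) by simp
    finally have "l j * lookup v m = lookup v m * zeta n m j"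
      using assms(1) j by (simp add: eigen_def)
    then show ?thesis using m(1) by (simp add: in_keys_iff)
  qed
  then show ?thesis using that[OF m(1) iv[OF m(1)]] by blast
qed

text \<open>By \<open>eigen_key\<close> and separation, a nonzero difference would contain the
  monomial of a, but the coefficients there cancel.\<close>

lemma eigen_unique:
  assumes a: "keys a \<subseteq> {1..n}"
    and E: "eigen n (zeta n a) E" "lookup E a = 1" and E': "eigen n (zeta n a) E'" "lookup E' a = 1"
  shows "E = E'"
proof (rule ccontr)
  assume "E \<noteq> E'"
  then have "E - E' \<noteq> 0" by simp
  moreover have "eigen n (zeta n a) (E - E')"
    using E(1) E'(1)
    by (auto simp: eigen_def in_vars_diff lin_diff[OF lin_Yop] right_diff_distrib)
  ultimately obtain m where m: "m \<in> keys (E - E')" "keys m \<subseteq> {1..n}"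
      "\<And>j. j \<in> {1..n} \<Longrightarrow> zeta n a j = zeta n m j"
    using eigen_key by blast
  then have "m = a" using exponent_eqI[OF m(2) a] zeta_eqD by metis
  then show False using m(1) E(2) E'(2) by (simp add: in_keys_iff lookup_minus)
qed

text \<open>The weak inequality to the right counts k + 1 for k, the strict one to the left does not
  count k for k + 1, and all other positions count alike.\<close>

lemma zeta_Suc:
  assumes "lookup a k = lookup a (Suc k)" "1 \<le> k" "k < n"
  shows "zeta n a k = tt * zeta n a (Suc k)"
proof -
  have "{m. 1 \<le> m \<and> m < Suc k \<and> lookup a m > lookup a (Suc k)}
      = {m. 1 \<le> m \<and> m < k \<and> lookup a m > lookup a k}"
    using assms(1) by (auto simp: less_Suc_eq)
  moreover have "{m. k < m \<and> m \<le> n \<and> lookup a m \<ge> lookup a k}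
      = insert (Suc k) {m. Suc k < m \<and> m \<le> n \<and> lookup a m \<ge> lookup a (Suc k)}"
    using assms by (auto simp: Suc_le_eq)
  moreover have "finite {m. Suc k < m \<and> m \<le> n \<and> lookup a m \<ge> lookup a (Suc k)}"
    by (rule finite_subset[of _ "{..n}"]) auto
  ultimately show ?thesis using assms(1) by (simp add: zeta_def)
qed

lemma DL_eigen:
  assumes a: "keys a \<subseteq> {1..n}" and k: "1 \<le> k" "k < n" and eq: "lookup a k = lookup a (Suc k)"
    and E: "eigen n (zeta n a) E"
  shows "DL k E = Cst tt * E"
proof (rule ccontr)
  assume "DL k E \<noteq> Cst tt * E"
  let ?d = "DL k E" and ?F = "DL k E - Cst tt * E"
  let ?x = "zeta n a k" and ?y = "zeta n a (Suc k)"
  define l where "l j = zeta n a (sw k j)" for j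
  have xy: "?x = tt * ?y" by (rule zeta_Suc[OF eq k])
  have ev: "Yop n j E = Cst (zeta n a j) * E" if "j \<in> {1..n}" for j
    using E that by (simp add: eigen_def)
  have kk: "k \<in> {1..n}" "Suc k \<in> {1..n}" using k by auto
  have 1: "DL k (Yop n (Suc k) ?d) = Cst tt * (Cst ?x * E)"
    using Yop_conj[OF k, of E] ev[OF kk(1)] by simp
  \<comment> \<open>Undoing the outer T_k in the conjugation relation gives Y_{k+1} on T_k E; the
    same relation at T_k E then gives Y_k.\<close>
  have "Yop n (Suc k) ?d = DLi k (DL k (Yop n (Suc k) ?d))" by (simp add: DLi_DL)
  also have "\<dots> = Cst tt * (Cst ?x * DLi k E)"
    unfolding 1 by (simp add: lin_scale[OF lin_DLi])
  also have "\<dots> = Cst (inverse tt) * (Cst tt * (Cst ?x * (?d - Cst (tt - 1) * E)))"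
    by (simp add: DLi_def mult_ac)
  also have "\<dots> = Cst ?x * (?d - Cst (tt - 1) * E)" by (rule Cst_inverse_tt)
  finally have Y': "Yop n (Suc k) ?d = Cst ?x * (?d - Cst (tt - 1) * E)" .
  have "Cst tt * Yop n k ?d = DL k (Yop n (Suc k) (DL k ?d))"
    using Yop_conj[OF k, of ?d] by simp
  also have "\<dots> = Cst (tt - 1) * (Cst tt * (Cst ?x * E)) + Cst tt * (Cst ?y * ?d)"
    by (simp add: DL_quadratic lin_add[OF lin_Yop] lin_scale[OF lin_Yop] lin_add[OF lin_DL]
        lin_scale[OF lin_DL] 1 ev[OF kk(2)])
  also have "\<dots> = Cst tt * (Cst (tt - 1) * (Cst ?x * E) + Cst ?y * ?d)"
    by (simp add: algebra_simps)
  finally have Y: "Yop n k ?d = Cst (tt - 1) * (Cst ?x * E) + Cst ?y * ?d"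
    by simp
  have "Yop n j ?F = Cst (l j) * ?F" if j: "j \<in> {1..n}" for j
  proof -
    \<comment> \<open>At k and k + 1 the relation x = t y is what turns y T_k E - x E into y (T_k E
      - t E), and similarly for x.\<close>
    consider "j = k" | "j = Suc k" | "j \<noteq> k" "j \<noteq> Suc k" by blast
    then show ?thesis
    proof cases
      case 1
      then show ?thesis
        by (simp add: l_def lin_diff[OF lin_Yop] lin_scale[OF lin_Yop] Y ev[OF kk(1)])
           (simp add: xy Cst_mult Cst_diff algebra_simps)
    next
      case 2
      then show ?thesis
        by (simp add: l_def lin_diff[OF lin_Yop] lin_scale[OF lin_Yop] Y' ev[OF kk(2)])
           (simp add: xy Cst_mult Cst_diff algebra_simps)
    next
      case 3
      then show ?thesis
        using Yop_DL_commute[OF j k 3, of E] ev[OF j]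
        by (simp add: l_def sw_other lin_diff[OF lin_Yop] lin_scale[OF lin_Yop] lin_scale[OF lin_DL]
            right_diff_distrib mult.left_commute)
    qed
  qed
  moreover have "in_vars n ?F"
    using E k by (auto simp: eigen_def intro!: in_vars_diff in_vars_DL in_vars_scale)
  ultimately have "eigen n l ?F" by (simp add: eigen_def)
  moreover have "?F \<noteq> 0" using \<open>DL k E \<noteq> Cst tt * E\<close> by simp
  ultimately obtain m where m: "keys m \<subseteq> {1..n}" "\<And>j. j \<in> {1..n} \<Longrightarrow> l j = zeta n m j"
    using eigen_key by blast
  \<comment> \<open>Swapping two equal entries does not change a, so the separated exponent is a
    itself.\<close>
  have "lookup m j = lookup a j" if "j \<in> {1..n}" for j
  proof -
    have "zeta n a (sw k j) = zeta n m j" using m(2)[OF that] by (simp add: l_def)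
    then have "lookup a (sw k j) = lookup m j" by (rule zeta_eqD)
    then show ?thesis using eq by (simp add: sw_def split: if_splits)
  qed
  then have "m = a" using exponent_eqI[OF m(1) a] by blast
  then have "?y = ?x" using m(2)[OF kk(1)] by (simp add: l_def)
  moreover have "?y \<noteq> 0" by (simp add: zeta_def)
  ultimately have "tt = 1" using xy by simp
  then have "inverse qq ^ 0 * tt ^ 0 = inverse qq ^ 0 * tt ^ 1" by simp
  then have "(0::nat) = 1" by (rule qq_tt_independent(2))
  then show False by simp
qed

section \<open>From exponent vectors to compositions\<close>

lemma lookup_xmono: "lookup (xmono alpha) j = (if j \<in> {1..length alpha} then cmp alpha j else 0)"
  unfolding xmono_def lookup_sum by (simp add: lookup_single when_def)

lemma keys_xmono: "keys (xmono alpha) \<subseteq> {1..length alpha}"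
  by (auto simp: in_keys_iff lookup_xmono split: if_splits)

lemma zeta_xmono:
  assumes "j \<in> {1..length alpha}"
  shows "zeta (length alpha) (xmono alpha) j = inverse qq ^ cmp alpha j * tt ^ kexp alpha j"
proof -
  have "{m. 1 \<le> m \<and> m < j \<and> lookup (xmono alpha) m > lookup (xmono alpha) j}
      = {m. 1 \<le> m \<and> m < j \<and> cmp alpha m > cmp alpha j}"
    "{m. j < m \<and> m \<le> length alpha \<and> lookup (xmono alpha) m \<ge> lookup (xmono alpha) j}
      = {m. j < m \<and> m \<le> length alpha \<and> cmp alpha m \<ge> cmp alpha j}"
    using assms by (auto simp: lookup_xmono)
  then show ?thesis using assms by (simp add: zeta_def kexp_def lookup_xmono)
qed

lemma eigen_Emac: "eigen (length alpha) (zeta (length alpha) (xmono alpha)) (Emac alpha)"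
proof -
  let ?n = "length alpha" and ?a = "xmono alpha"
  have iff: "in_vars ?n E \<and> lookup E ?a = 1 \<and>
      (\<forall>j\<in>{1..?n}. Yop ?n j E = Cst (inverse qq ^ cmp alpha j * tt ^ kexp alpha j) * E)
    \<longleftrightarrow> eigen ?n (zeta ?n ?a) E \<and> lookup E ?a = 1" for E
    by (auto simp: eigen_def zeta_xmono)
  have "\<exists>!E. eigen ?n (zeta ?n ?a) E \<and> lookup E ?a = 1"
    using eigen_exists eigen_unique keys_xmono by blast
  from theI'[OF this] show ?thesis
    unfolding Emac_def iff by (rule conjunct1)
qed

lemma DL_Emac:
  assumes "1 \<le> k" "k < length alpha" "cmp alpha k = cmp alpha (Suc k)"
  shows "DL k (Emac alpha) = Cst tt * Emac alpha"
proof (rule DL_eigen[OF keys_xmono[of alpha] _ _ _ eigen_Emac])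
  show "lookup (xmono alpha) k = lookup (xmono alpha) (Suc k)"
    using assms by (simp add: lookup_xmono)
qed (rule assms)+

text \<open>Frees \<open>Tperm\<close> from the reduced word selected by
  \<open>SOME\<close>.\<close>

lemma Tperm_reduced_word:
  assumes "reduced_word n p ws"
  shows "Tperm n p f = foldr DL ws f"
  unfolding Tperm_def
proof (rule matsumoto[where T = DL])
  show "reduced_word n p (SOME ws. reduced_word n p ws)" using assms by (rule someI)
  show "reduced_word n p ws" by (rule assms)
  show "DL i (DL (Suc i) (DL i f)) = DL (Suc i) (DL i (DL (Suc i) f))" for i f
    by (rule DL_braid)
  show "DL i (DL j f) = DL j (DL i f)" if "Suc i < j" for i j f
    using that by (rule DL_far)
qed

lemma Tperm_descent:
  assumes "p permutes {1..n}" "1 \<le> k" "k < n" "p (Suc k) < p k"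
  shows "Tperm n p f = Tperm n (p \<circ> sw k) (DL k f)"
proof -
  have "p \<circ> sw k permutes {1..n}"
    using permutes_compose[OF sw_permutes assms(1)] assms by blast
  then obtain ws where ws: "reduced_word n (p \<circ> sw k) ws" using reduced_word_exists by blast
  then have "reduced_word n p (ws @ [k])" using assms by (intro reduced_word_snocI)
  then show ?thesis using ws by (simp add: Tperm_reduced_word)
qed

lemma lin_Tperm: "lin (Tperm n p)"
proof -
  have "lin (foldr DL ws)" for ws
    by (induction ws) (auto simp: lin_id id_def o_def lin_DL intro: lin_compose)
  then show ?thesis by (simp add: Tperm_def[abs_def])
qed

section \<open>Reversal and change of basement\<close>

lemma w0_permutes: "w0 n permutes {1..n}"
proof (rule bij_imp_permutes)
  show "bij_betw (w0 n) {1..n} {1..n}"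
    by (rule bij_betw_byWitness[where f' = "w0 n"]) (auto simp: w0_def)
qed (auto simp: w0_def)

text \<open>Conjugation by w_0 turns s_i into s_{n-i}.\<close>

lemma prev_sw:
  assumes "1 \<le> i" "i < n"
  shows "prev n (\<sigma> \<circ> sw i) = prev n \<sigma> \<circ> sw (n - i)"
proof -
  have w0: "w0 n (n - i) = Suc i" "w0 n (Suc (n - i)) = i"
    using assms by (auto simp: w0_def)
  have "sw i (w0 n j) = w0 n (sw (n - i) j)" for j
  proof -
    consider "j = n - i" | "j = Suc (n - i)" | "j \<noteq> n - i" "j \<noteq> Suc (n - i)" by blast
    then show ?thesis
    proof cases
      case 3
      then have "w0 n j \<noteq> i" "w0 n j \<noteq> Suc i" using assms by (auto simp: w0_def)
      then show ?thesis using 3 by (simp add: sw_other)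
    qed (simp_all add: w0)
  qed
  then show ?thesis by (simp add: prev_def fun_eq_iff)
qed

text \<open>Equal entries make the comparison in \<open>alpha\<close> invariant under the swap, so
  only the pair (i, i + 1) is lost.\<close>

lemma twinv_sw:
  assumes "1 \<le> i" "i < length alpha" "cmp alpha i = cmp alpha (Suc i)" "\<sigma> i < \<sigma> (Suc i)"
  shows "twinv alpha \<sigma> = Suc (twinv alpha (\<sigma> \<circ> sw i))"
proof -
  have c: "cmp alpha (sw i j) = cmp alpha j" for j
    using assms(3) by (simp add: sw_def)
  show ?thesis
    using npairs_sw[OF assms(1,2), of "\<lambda>j m. cmp alpha j \<ge> cmp alpha m \<and> \<sigma> j < \<sigma> m"] assms(3,4)
    by (simp add: npairs_def twinv_def c)
qed

lemma cmp_rev: "1 \<le> j \<Longrightarrow> j \<le> length alpha \<Longrightarrow> cmp (rev alpha) j = cmp alpha (Suc (length alpha) - j)"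
  by (simp add: cmp_def rev_nth Suc_diff_le)

lemma Ebase_sw_ascent:
  assumes "\<sigma> permutes {1..length alpha}" and i: "1 \<le> i" "i < length alpha"
    and "cmp alpha i = cmp alpha (Suc i)" and "\<sigma> i < \<sigma> (Suc i)"
  shows "Ebase alpha \<sigma> = Ebase alpha (\<sigma> \<circ> sw i)"
proof -
  let ?n = "length alpha" and ?E = "Emac (rev alpha)" and ?p = "prev (length alpha) \<sigma>"
  \<comment> \<open>Reversal carries positions i + 1 and i to k and k + 1, so equal entries stay
    adjacent and an ascent of \<sigma> becomes a descent.\<close>
  define k where "k = ?n - i"
  have k: "1 \<le> k" "k < ?n" "Suc ?n - k = Suc i" "Suc ?n - Suc k = i" using i by (auto simp: k_def)
  have "?p permutes {1..?n}"
    unfolding prev_def by (rule permutes_compose[OF w0_permutes assms(1)])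
  moreover have "?p (Suc k) < ?p k"
    using k assms(5) by (simp add: prev_def w0_def)
  ultimately have "Tperm ?n ?p ?E = Tperm ?n (prev ?n (\<sigma> \<circ> sw i)) (DL k ?E)"
    using Tperm_descent k prev_sw[OF i] by (simp add: k_def)
  also have "DL k ?E = Cst tt * ?E"
    using k assms(4) by (intro DL_Emac) (simp_all add: cmp_rev)
  also have "Tperm ?n (prev ?n (\<sigma> \<circ> sw i)) (Cst tt * ?E)
      = Cst tt * Tperm ?n (prev ?n (\<sigma> \<circ> sw i)) ?E"
    by (rule lin_scale[OF lin_Tperm])
  finally have T: "Tperm ?n ?p ?E = Cst tt * Tperm ?n (prev ?n (\<sigma> \<circ> sw i)) ?E" .
  \<comment> \<open>The factor t from T_k cancels the one extra power of t^{-1} supplied by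
    \<open>twinv_sw\<close>.\<close>
  have "Cst (inverse tt ^ Suc w) * (Cst tt * h) = Cst (inverse tt ^ w) * h" for w h
  proof -
    have "inverse tt ^ Suc w * tt = inverse tt ^ w" by simp
    then show ?thesis by (simp only: flip: mult.assoc Cst_mult)
  qed
  then show ?thesis
    unfolding Ebase_def twinv_sw[where \<sigma> = \<sigma>, OF i assms(4,5)] T .
qed

theorem theorem1p2:
  fixes alpha :: "nat list" and \<sigma> :: "nat \<Rightarrow> nat" and i :: nat
  assumes "\<sigma> permutes {1..length alpha}"
    and "1 \<le> i" and "i < length alpha"
    and "cmp alpha i = cmp alpha (i + 1)"
  shows "Ebase alpha \<sigma> = Ebase alpha (\<sigma> \<circ> sw i)"
proof (cases "\<sigma> i < \<sigma> (Suc i)")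
  case True
  then show ?thesis using assms by (intro Ebase_sw_ascent) auto
next
  case False
  moreover have "\<sigma> i \<noteq> \<sigma> (Suc i)"
    using permutes_inj[OF assms(1)] by (metis injD n_not_Suc_n)
  moreover have "\<sigma> \<circ> sw i permutes {1..length alpha}"
    using permutes_compose[OF sw_permutes assms(1)] assms by blast
  \<comment> \<open>At a descent of \<sigma> the swapped permutation has an ascent, and swapping it
    again returns \<sigma>.\<close>
  ultimately have "Ebase alpha (\<sigma> \<circ> sw i) = Ebase alpha (\<sigma> \<circ> sw i \<circ> sw i)"
    using assms by (intro Ebase_sw_ascent) auto
  then show ?thesis by simp
qed

end
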